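(* Fix $n\geq 3$ and a 2-category $\mathcal{B}$. The 2-category $\mathrm{Mnd}^n(\mathcal{B})$ is given as follows. **0-cells.** A 0-cell consists of a tuple $\big(X,\{S_i\}_{1\le i\le n},\{\lambda_{ij}\}_{1\le i<j\le n}\big)$ where - $X$ is a 0-cell of $\mathcal{B}$, - each $S_i$ is a monad on $X$, - each $\lambda_{ij}: S_iS_j\Rightarrow S_jS_i$ is a distributive law of $S_i$ over $S_j$, and - for all $i<j<k$ the monads $S_i,S_j,S_k$ satisfy the Yang–Baxter equation $$\lambda_{jk}S_i\circ S_j\lambda_{ik}\circ\lambda_{ij}S_k = S_k\lambda_{ij}\circ\lambda_{ik}S_j\circ S_i\lambda_{jk} : S_iS_jS_k\Rightarrow S_kS_jS_i .$$ **1-cells.** A 1-cell $\big(X,\{S_i\},\{\lambda_{ij}\}\big)\to\big(X',\{S'_i\},\{\lambda'_{ij}\}\big)$ is a tuple $\big(T,\{\tau_i\}_{1\le i\le n}\big)$ where - $T:X\to X'$ is a 1-cell of $\mathcal{B}$, - each $\tau_i: S'_iT\Rightarrow TS_i$ is a 2-cell of $\mathcal{B}$, - for all $1\le i\le n$, $$\tau_i\circ\eta^{S'_i}T = T\eta^{S_i},\qquad \tau_i\circ\mu^{S'_i}T = T\mu^{S_i}\circ\tau_iS_i\circ S'_i\tau_i,$$ i.e. each $(T,\tau_i)$ is a morphism $(X,S_i)\to(X',S'_i)$ in $\mathrm{Mnd}(\mathcal{B})$, and - for all $i<j$, $$\tau_jS_i\circ S'_j\tau_i\circ\lambda'_{ij}T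 = T\lambda_{ij}\circ\tau_iS_j\circ S'_i\tau_j : S'_iS'_jT\Rightarrow TS_jS_i .$$ The composite of 1-cells $(T,\{\tau_i\}):(X,\{S_i\},\{\lambda_{ij}\})\to(X',\{S'_i\},\{\lambda'_{ij}\})$ and $(T',\{\tau'_i\}):(X',\{S'_i\},\{\lambda'_{ij}\})\to(X'',\{S''_i\},\{\lambda''_{ij}\})$ is $\big(T'T,\{T'\tau_i\circ\tau'_iT\}\big)$. **2-cells.** A 2-cell $(T,\{\tau_i\})\Rightarrow(T',\{\tau'_i\})$ between 1-cells $(X,\{S_i\},\{\lambda_{ij}\})\to(X',\{S'_i\},\{\lambda'_{ij}\})$ consists of a 2-cell $\alpha:T\Rightarrow T'$ of $\mathcal{B}$ such that for all $1\le i\le n$ $$\alpha S_i\circ\tau_i = \tau'_i\circ S'_i\alpha,$$ i.e. $\alpha$ is a 2-cell $(T,\tau_i)\Rightarrow(T',\tau'_i)$ in $\mathrm{Mnd}(\mathcal{B})$ for all $i$. 2-cell composition is inherited from $\mathcal{B}$.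
   Context: Juxtaposition denotes composition of 1-cells and whiskering; $\circ$ denotes vertical composition of 2-cells. For a 2-category $\mathcal{B}$, the 2-category $\mathrm{Mnd}(\mathcal{B})$ (Street) is defined as follows. A 0-cell is a monad in $\mathcal{B}$: a pair $(X,S)$ of a 0-cell $X$ and a 1-cell $S:X\to X$ with 2-cells $\eta^S:1\Rightarrow S$, $\mu^S:S^2\Rightarrow S$ satisfying the usual unit and associativity axioms. A 1-cell $(X,S)\to(X',S')$ is a pair $(T,\lambda)$ of a 1-cell $T:X\to X'$ and a 2-cell $\lambda:S'T\Rightarrow TS$ with $\lambda\circ\eta^{S'}T=T\eta^S$ and $\lambda\circ\mu^{S'}T=T\mu^S\circ\lambda S\circ S'\lambda$. A 2-cell $(T,\lambda)\Rightarrow(T',\lambda')$ is a 2-cell $\alpha:T\Rightarrow T'$ with $\alpha S\circ\lambda=\lambda'\circ S'\alpha$. The composite of $(T,\lambda):(X,S)\to(X',S')$ and $(T',\lambda'):(X',S')\to(X'',S'')$ is $(T'T,\,T'\lambda\circ\lambda'T)$; the identity is $(1,1)$; 2-cell composition is inherited from $\mathcal{B}$. $\mathrm{Mnd}^n(\mathcal{B})$ is the $n$-fold iterate: $\mathrm{Mnd}^1(\mathcal{B})=\mathrm{Mnd}(\mathcal{B})$, $\mathrm{Mnd}^n(\mathcal{B})=\mathrm{Mnd}(\mathrm{Mnd}^{n-1}(\mathcal{B}))$. The description "is given as follows" is meant up to the evident re-bracketing of data: the tuple $(X,\{S_i\},\{\lambda_{ij}\})$ corresponds to the monad in $\mathrm{Mnd}^{n-1}(\mathcal{B})$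 on the 0-cell $(X,\{S_i\}_{i\le n-1},\{\lambda_{ij}\}_{i<j\le n-1})$ with underlying endo-1-cell $(S_n,\{\lambda_{in}\}_{i\le n-1})$ and unit and multiplication 2-cells $\eta^{S_n},\mu^{S_n}$, and a 1-cell $(T,\{\tau_i\}_{i\le n})$ corresponds to the 1-cell $\big((T,\{\tau_i\}_{i\le n-1}),\tau_n\big)$. Distributive law of $S$ over $T$, for monads $S,T$ on a 0-cell $X$ of a 2-category: a 2-cell $\lambda:ST\Rightarrow TS$ with $\lambda\circ\eta^ST=T\eta^S$, $\lambda\circ\mu^ST=T\mu^S\circ\lambda S\circ S\lambda$, $\lambda\circ S\eta^T=\eta^TS$, $\lambda\circ S\mu^T=\mu^TS\circ T\lambda\circ\lambda T$. *)

theory Defs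
  imports Main "HOL-Library.FuncSet"
begin

section \<open>Strict 2-categories\<close>

text \<open>
  \<open>Hom B X Y\<close> is the set of 1-cells \<open>X \<rightarrow> Y\<close>, and \<open>Cell B X Y f g\<close> the set of 2-cells \<open>f \<Rightarrow> g\<close>
  between 1-cells \<open>f, g : X \<rightarrow> Y\<close>. These sets need not be disjoint for different boundaries: a cell
  does not record its boundary, and the value of an operation depends on the cells only. Every
  2-category can be presented in this form (for instance with disjoint hom-sets), and the form is
  stable under the monad construction below, where the same pair \<open>(T, \<lambda>)\<close> may be a 1-cell between
  several pairs of monads.

  All composites are written in the order of function composition: \<open>g \<cdot> f\<close> means \<open>f\<close> first.
\<close>

record ('o, 'a, 'c) two_cat =
  Obj :: "'o set"
  Hom :: "'o \<Rightarrow> 'o \<Rightarrow> 'a set"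
  Cell :: "'o \<Rightarrow> 'o \<Rightarrow> 'a \<Rightarrow> 'a \<Rightarrow> 'c set"
  Id1 :: "'o \<Rightarrow> 'a"
  Comp :: "'a \<Rightarrow> 'a \<Rightarrow> 'a"  (infixr "\<cdot>\<index>" 80)
  Id2 :: "'a \<Rightarrow> 'c"
  VComp :: "'c \<Rightarrow> 'c \<Rightarrow> 'c"  (infixr "\<bullet>\<index>" 70)
  HComp :: "'c \<Rightarrow> 'c \<Rightarrow> 'c"  (infixr "\<star>\<index>" 75)

definition whisker_left :: "('o, 'a, 'c) two_cat \<Rightarrow> 'a \<Rightarrow> 'c \<Rightarrow> 'c"  (infixr "\<lhd>\<index>" 75)
  where "f \<lhd>\<^bsub>B\<^esub> \<alpha> = Id2 B f \<star>\<^bsub>B\<^esub> \<alpha>"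

definition whisker_right :: "('o, 'a, 'c) two_cat \<Rightarrow> 'c \<Rightarrow> 'a \<Rightarrow> 'c"  (infixl "\<rhd>\<index>" 75)
  where "\<alpha> \<rhd>\<^bsub>B\<^esub> f = \<alpha> \<star>\<^bsub>B\<^esub> Id2 B f"

locale two_category =
  fixes B :: "('o, 'a, 'c) two_cat" (structure)
  assumes Id1_in_Hom: "X \<in> Obj B \<Longrightarrow> Id1 B X \<in> Hom B X X"
    and Comp_in_Hom: "\<lbrakk>X \<in> Obj B; Y \<in> Obj B; Z \<in> Obj B; f \<in> Hom B X Y; g \<in> Hom B Y Z\<rbrakk>
      \<Longrightarrow> g \<cdot> f \<in> Hom B X Z"
    and Comp_assoc: "\<lbrakk>W \<in> Obj B; X \<in> Obj B; Y \<in> Obj B; Z \<in> Obj B;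
        f \<in> Hom B W X; g \<in> Hom B X Y; h \<in> Hom B Y Z\<rbrakk>
      \<Longrightarrow> (h \<cdot> g) \<cdot> f = h \<cdot> (g \<cdot> f)"
    and Comp_Id1_left: "\<lbrakk>X \<in> Obj B; Y \<in> Obj B; f \<in> Hom B X Y\<rbrakk> \<Longrightarrow> Id1 B Y \<cdot> f = f"
    and Comp_Id1_right: "\<lbrakk>X \<in> Obj B; Y \<in> Obj B; f \<in> Hom B X Y\<rbrakk> \<Longrightarrow> f \<cdot> Id1 B X = f"
    and Id2_in_Cell: "\<lbrakk>X \<in> Obj B; Y \<in> Obj B; f \<in> Hom B X Y\<rbrakk> \<Longrightarrow> Id2 B f \<in> Cell B X Y f f"
    and VComp_in_Cell: "\<lbrakk>X \<in> Obj B; Y \<in> Obj B;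
        f \<in> Hom B X Y; g \<in> Hom B X Y; h \<in> Hom B X Y;
        \<alpha> \<in> Cell B X Y f g; \<beta> \<in> Cell B X Y g h\<rbrakk>
      \<Longrightarrow> \<beta> \<bullet> \<alpha> \<in> Cell B X Y f h"
    and VComp_assoc: "\<lbrakk>X \<in> Obj B; Y \<in> Obj B;
        f \<in> Hom B X Y; g \<in> Hom B X Y; h \<in> Hom B X Y; k \<in> Hom B X Y;
        \<alpha> \<in> Cell B X Y f g; \<beta> \<in> Cell B X Y g h; \<gamma> \<in> Cell B X Y h k\<rbrakk>
      \<Longrightarrow> (\<gamma> \<bullet> \<beta>) \<bullet> \<alpha> = \<gamma> \<bullet> (\<beta> \<bullet> \<alpha>)"
    and VComp_Id2_left: "\<lbrakk>X \<in> Obj B; Y \<in> Obj B; f \<in> Hom B X Y; g \<in> Hom B X Y;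
        \<alpha> \<in> Cell B X Y f g\<rbrakk> \<Longrightarrow> Id2 B g \<bullet> \<alpha> = \<alpha>"
    and VComp_Id2_right: "\<lbrakk>X \<in> Obj B; Y \<in> Obj B; f \<in> Hom B X Y; g \<in> Hom B X Y;
        \<alpha> \<in> Cell B X Y f g\<rbrakk> \<Longrightarrow> \<alpha> \<bullet> Id2 B f = \<alpha>"
    and HComp_in_Cell: "\<lbrakk>X \<in> Obj B; Y \<in> Obj B; Z \<in> Obj B;
        f \<in> Hom B X Y; f' \<in> Hom B X Y; g \<in> Hom B Y Z; g' \<in> Hom B Y Z;
        \<alpha> \<in> Cell B X Y f f'; \<beta> \<in> Cell B Y Z g g'\<rbrakk>
      \<Longrightarrow> \<beta> \<star> \<alpha> \<in> Cell B X Z (g \<cdot> f) (g' \<cdot> f')"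
    and HComp_assoc: "\<lbrakk>W \<in> Obj B; X \<in> Obj B; Y \<in> Obj B; Z \<in> Obj B;
        f \<in> Hom B W X; f' \<in> Hom B W X; g \<in> Hom B X Y; g' \<in> Hom B X Y;
        h \<in> Hom B Y Z; h' \<in> Hom B Y Z;
        \<alpha> \<in> Cell B W X f f'; \<beta> \<in> Cell B X Y g g'; \<gamma> \<in> Cell B Y Z h h'\<rbrakk>
      \<Longrightarrow> (\<gamma> \<star> \<beta>) \<star> \<alpha> = \<gamma> \<star> (\<beta> \<star> \<alpha>)"
    and HComp_Id_left: "\<lbrakk>X \<in> Obj B; Y \<in> Obj B; f \<in> Hom B X Y; f' \<in> Hom B X Y;
        \<alpha> \<in> Cell B X Y f f'\<rbrakk> \<Longrightarrow> Id2 B (Id1 B Y) \<star> \<alpha> = \<alpha>"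
    and HComp_Id_right: "\<lbrakk>X \<in> Obj B; Y \<in> Obj B; f \<in> Hom B X Y; f' \<in> Hom B X Y;
        \<alpha> \<in> Cell B X Y f f'\<rbrakk> \<Longrightarrow> \<alpha> \<star> Id2 B (Id1 B X) = \<alpha>"
    and HComp_Id2: "\<lbrakk>X \<in> Obj B; Y \<in> Obj B; Z \<in> Obj B; f \<in> Hom B X Y; g \<in> Hom B Y Z\<rbrakk>
      \<Longrightarrow> Id2 B g \<star> Id2 B f = Id2 B (g \<cdot> f)"
    and interchange: "\<lbrakk>X \<in> Obj B; Y \<in> Obj B; Z \<in> Obj B;
        f \<in> Hom B X Y; f' \<in> Hom B X Y; f'' \<in> Hom B X Y;
        g \<in> Hom B Y Z; g' \<in> Hom B Y Z; g'' \<in> Hom B Y Z;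
        \<alpha> \<in> Cell B X Y f f'; \<alpha>' \<in> Cell B X Y f' f'';
        \<beta> \<in> Cell B Y Z g g'; \<beta>' \<in> Cell B Y Z g' g''\<rbrakk>
      \<Longrightarrow> (\<beta>' \<bullet> \<beta>) \<star> (\<alpha>' \<bullet> \<alpha>) = (\<beta>' \<star> \<alpha>') \<bullet> (\<beta> \<star> \<alpha>)"

text \<open>An isomorphism of 2-categories: a strict 2-functor that is bijective on cells of each dimension.\<close>

locale two_category_iso = A: two_category A + B: two_category B
  for A :: "('o, 'a, 'c) two_cat" and B :: "('p, 'b, 'd) two_cat"
    and F0 :: "'o \<Rightarrow> 'p" and F1 :: "'a \<Rightarrow> 'b" and F2 :: "'c \<Rightarrow> 'd" +
  assumes bij_Obj: "bij_betw F0 (Obj A) (Obj B)"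
    and bij_Hom: "\<lbrakk>X \<in> Obj A; Y \<in> Obj A\<rbrakk> \<Longrightarrow> bij_betw F1 (Hom A X Y) (Hom B (F0 X) (F0 Y))"
    and bij_Cell: "\<lbrakk>X \<in> Obj A; Y \<in> Obj A; f \<in> Hom A X Y; g \<in> Hom A X Y\<rbrakk>
      \<Longrightarrow> bij_betw F2 (Cell A X Y f g) (Cell B (F0 X) (F0 Y) (F1 f) (F1 g))"
    and map_Id1: "X \<in> Obj A \<Longrightarrow> F1 (Id1 A X) = Id1 B (F0 X)"
    and map_Comp: "\<lbrakk>X \<in> Obj A; Y \<in> Obj A; Z \<in> Obj A; f \<in> Hom A X Y; g \<in> Hom A Y Z\<rbrakk>
      \<Longrightarrow> F1 (g \<cdot>\<^bsub>A\<^esub> f) = F1 g \<cdot>\<^bsub>B\<^esub> F1 f"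
    and map_Id2: "\<lbrakk>X \<in> Obj A; Y \<in> Obj A; f \<in> Hom A X Y\<rbrakk> \<Longrightarrow> F2 (Id2 A f) = Id2 B (F1 f)"
    and map_VComp: "\<lbrakk>X \<in> Obj A; Y \<in> Obj A;
        f \<in> Hom A X Y; g \<in> Hom A X Y; h \<in> Hom A X Y;
        \<alpha> \<in> Cell A X Y f g; \<beta> \<in> Cell A X Y g h\<rbrakk>
      \<Longrightarrow> F2 (\<beta> \<bullet>\<^bsub>A\<^esub> \<alpha>) = F2 \<beta> \<bullet>\<^bsub>B\<^esub> F2 \<alpha>"
    and map_HComp: "\<lbrakk>X \<in> Obj A; Y \<in> Obj A; Z \<in> Obj A;
        f \<in> Hom A X Y; f' \<in> Hom A X Y; g \<in> Hom A Y Z; g' \<in> Hom A Y Z;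
        \<alpha> \<in> Cell A X Y f f'; \<beta> \<in> Cell A Y Z g g'\<rbrakk>
      \<Longrightarrow> F2 (\<beta> \<star>\<^bsub>A\<^esub> \<alpha>) = F2 \<beta> \<star>\<^bsub>B\<^esub> F2 \<alpha>"

section \<open>Monads and the 2-category \<open>Mnd(B)\<close>\<close>

datatype ('a, 'c) monad = Monad (End: 'a) (Unit: 'c) (Mult: 'c)

definition is_monad :: "('o, 'a, 'c) two_cat \<Rightarrow> 'o \<Rightarrow> ('a, 'c) monad \<Rightarrow> bool"
  where
  "is_monad B X S \<longleftrightarrow>
     End S \<in> Hom B X X \<and>
     Unit S \<in> Cell B X X (Id1 B X) (End S) \<and>
     Mult S \<in> Cell B X X (End S \<cdot> End S) (End S) \<and>
     Mult S \<bullet> (Unit S \<rhd> End S) = Id2 B (End S) \<and>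
     Mult S \<bullet> (End S \<lhd> Unit S) = Id2 B (End S) \<and>
     Mult S \<bullet> (Mult S \<rhd> End S) = Mult S \<bullet> (End S \<lhd> Mult S)"
  for B (structure)

definition is_monad_morphism ::
    "('o, 'a, 'c) two_cat \<Rightarrow> 'o \<times> ('a, 'c) monad \<Rightarrow> 'o \<times> ('a, 'c) monad \<Rightarrow> 'a \<times> 'c \<Rightarrow> bool"
  where
  "is_monad_morphism B = (\<lambda>(X, S) (X', S') (T, \<tau>).
     T \<in> Hom B X X' \<and>
     \<tau> \<in> Cell B X X' (End S' \<cdot> T) (T \<cdot> End S) \<and>
     \<tau> \<bullet> (Unit S' \<rhd> T) = T \<lhd> Unit S \<and>
     \<tau> \<bullet> (Mult S' \<rhd> T) = (T \<lhd> Mult S) \<bullet> (\<tau> \<rhd> End S) \<bullet> (End S' \<lhd> \<tau>))"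
  for B (structure)

definition is_monad_2cell ::
    "('o, 'a, 'c) two_cat \<Rightarrow> 'o \<times> ('a, 'c) monad \<Rightarrow> 'o \<times> ('a, 'c) monad
      \<Rightarrow> 'a \<times> 'c \<Rightarrow> 'a \<times> 'c \<Rightarrow> 'c \<Rightarrow> bool"
  where
  "is_monad_2cell B = (\<lambda>(X, S) (X', S') (T, \<tau>) (T', \<tau>') \<alpha>.
     \<alpha> \<in> Cell B X X' T T' \<and>
     (\<alpha> \<rhd> End S) \<bullet> \<tau> = \<tau>' \<bullet> (End S' \<lhd> \<alpha>))"
  for B (structure)

definition Mnd ::
    "('o, 'a, 'c) two_cat \<Rightarrow> ('o \<times> ('a, 'c) monad, 'a \<times> 'c, 'c) two_cat"
  where
  "Mnd B =
    \<lparr>Obj = {(X, S). X \<in> Obj B \<and> is_monad B X S},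
     Hom = (\<lambda>XS XS'. {T\<tau>. is_monad_morphism B XS XS' T\<tau>}),
     Cell = (\<lambda>XS XS' T\<tau> T\<tau>'. {\<alpha>. is_monad_2cell B XS XS' T\<tau> T\<tau>' \<alpha>}),
     Id1 = (\<lambda>(X, S). (Id1 B X, Id2 B (End S))),
     Comp = (\<lambda>(T', \<tau>') (T, \<tau>). (T' \<cdot> T, (T' \<lhd> \<tau>) \<bullet> (\<tau>' \<rhd> T))),
     Id2 = (\<lambda>(T, \<tau>). Id2 B T),
     VComp = VComp B,
     HComp = HComp B\<rparr>"
  for B (structure)

section \<open>The iterates of \<open>Mnd\<close>\<close>

text \<open>
  The cells of \<open>Mnd B\<close> do not have the same types as those of \<open>B\<close>, so \<open>Mnd\<close> cannot be iterated a
  variable number of times as it stands. The datatypes below contain the 0-cells and 1-cells of all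
  iterates: \<open>Pair0\<close> and \<open>Pair1\<close> stand for the pairs \<open>(X, S)\<close> and \<open>(T, \<tau>)\<close> that are the cells of
  \<open>Mnd\<close>. The 2-cells of every iterate are 2-cells of \<open>B\<close>.
\<close>

datatype ('a, 'c) cell1 = Base1 'a | Pair1 "('a, 'c) cell1" 'c

datatype ('o, 'a, 'c) cell0 = Base0 'o | Pair0 "('o, 'a, 'c) cell0" "(('a, 'c) cell1, 'c) monad"

text \<open>The isomorphic copy of \<open>B\<close> obtained by renaming its cells along injections \<open>\<phi>\<close> and \<open>\<psi>\<close>.\<close>

definition rename_cells ::
    "('o \<Rightarrow> 'p) \<Rightarrow> ('a \<Rightarrow> 'b) \<Rightarrow> ('o, 'a, 'c) two_cat \<Rightarrow> ('p, 'b, 'c) two_cat"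
  where
  "rename_cells \<phi> \<psi> B =
    \<lparr>Obj = \<phi> ` Obj B,
     Hom = (\<lambda>X Y. \<psi> ` Hom B (inv \<phi> X) (inv \<phi> Y)),
     Cell = (\<lambda>X Y f g. Cell B (inv \<phi> X) (inv \<phi> Y) (inv \<psi> f) (inv \<psi> g)),
     Id1 = (\<lambda>X. \<psi> (Id1 B (inv \<phi> X))),
     Comp = (\<lambda>g f. \<psi> (inv \<psi> g \<cdot> inv \<psi> f)),
     Id2 = (\<lambda>f. Id2 B (inv \<psi> f)),
     VComp = VComp B,
     HComp = HComp B\<rparr>"
  for B (structure)

text \<open>\<open>Mnd_pow n B\<close> is the \<open>n\<close>-fold iterate, starting from a copy of \<open>B\<close> itself for \<open>n = 0\<close>.\<close>

primrec Mnd_pow ::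
    "nat \<Rightarrow> ('o, 'a, 'c) two_cat \<Rightarrow> (('o, 'a, 'c) cell0, ('a, 'c) cell1, 'c) two_cat" where
  "Mnd_pow 0 B = rename_cells Base0 Base1 B"
| "Mnd_pow (Suc n) B =
     rename_cells (\<lambda>(X, S). Pair0 X S) (\<lambda>(T, \<tau>). Pair1 T \<tau>) (Mnd (Mnd_pow n B))"

section \<open>The explicit description by tuples\<close>

text \<open>\<open>is_distributive_law B X S T \<lambda>\<close>: \<open>\<lambda> : S T \<Rightarrow> T S\<close> is a distributive law of \<open>S\<close> over \<open>T\<close>.\<close>

definition is_distributive_law ::
    "('o, 'a, 'c) two_cat \<Rightarrow> 'o \<Rightarrow> ('a, 'c) monad \<Rightarrow> ('a, 'c) monad \<Rightarrow> 'c \<Rightarrow> bool"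
  where
  "is_distributive_law B X S T l \<longleftrightarrow>
     l \<in> Cell B X X (End S \<cdot> End T) (End T \<cdot> End S) \<and>
     l \<bullet> (Unit S \<rhd> End T) = End T \<lhd> Unit S \<and>
     l \<bullet> (Mult S \<rhd> End T) = (End T \<lhd> Mult S) \<bullet> (l \<rhd> End S) \<bullet> (End S \<lhd> l) \<and>
     l \<bullet> (End S \<lhd> Unit T) = Unit T \<rhd> End S \<and>
     l \<bullet> (End S \<lhd> Mult T) = (Mult T \<rhd> End S) \<bullet> (End T \<lhd> l) \<bullet> (l \<rhd> End T)"
  for B (structure)

definition yang_baxter ::
    "('o, 'a, 'c) two_cat \<Rightarrow> 'a \<Rightarrow> 'a \<Rightarrow> 'a \<Rightarrow> 'c \<Rightarrow> 'c \<Rightarrow> 'c \<Rightarrow> bool"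
  where
  "yang_baxter B Si Sj Sk lij lik ljk \<longleftrightarrow>
     (ljk \<rhd> Si) \<bullet> (Sj \<lhd> lik) \<bullet> (lij \<rhd> Sk) = (Sk \<lhd> lij) \<bullet> (lik \<rhd> Sj) \<bullet> (Si \<lhd> ljk)"
  for B (structure)

text \<open>
  A family indexed by \<open>1 \<le> i \<le> n\<close>, or by pairs \<open>1 \<le> i < j \<le> n\<close>, is a function that is \<open>extensional\<close>,
  i.e. takes the dummy value \<open>undefined\<close> outside its index set, so that families agreeing on the
  index set are equal.
\<close>

type_synonym ('o, 'a, 'c) tuple0 = "'o \<times> (nat \<Rightarrow> ('a, 'c) monad) \<times> (nat \<times> nat \<Rightarrow> 'c)"
type_synonym ('a, 'c) tuple1 = "'a \<times> (nat \<Rightarrow> 'c)"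

definition index_pairs :: "nat \<Rightarrow> (nat \<times> nat) set" where
  "index_pairs n = {(i, j). 1 \<le> i \<and> i < j \<and> j \<le> n}"

definition is_tuple0 :: "nat \<Rightarrow> ('o, 'a, 'c) two_cat \<Rightarrow> ('o, 'a, 'c) tuple0 \<Rightarrow> bool" where
  "is_tuple0 n B = (\<lambda>(X, S, l).
     X \<in> Obj B \<and> S \<in> extensional {1..n} \<and> l \<in> extensional (index_pairs n) \<and>
     (\<forall>i\<in>{1..n}. is_monad B X (S i)) \<and>
     (\<forall>(i, j)\<in>index_pairs n. is_distributive_law B X (S i) (S j) (l (i, j))) \<and>
     (\<forall>i j k. 1 \<le> i \<and> i < j \<and> j < k \<and> k \<le> n \<longrightarrow>
        yang_baxter B (End (S i)) (End (S j)) (End (S k)) (l (i, j)) (l (i, k)) (l (j, k))))"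

definition is_tuple1 ::
    "nat \<Rightarrow> ('o, 'a, 'c) two_cat \<Rightarrow> ('o, 'a, 'c) tuple0 \<Rightarrow> ('o, 'a, 'c) tuple0
      \<Rightarrow> ('a, 'c) tuple1 \<Rightarrow> bool"
  where
  "is_tuple1 n B = (\<lambda>(X, S, l) (X', S', l') (T, \<tau>).
     T \<in> Hom B X X' \<and> \<tau> \<in> extensional {1..n} \<and>
     (\<forall>i\<in>{1..n}.
        \<tau> i \<in> Cell B X X' (End (S' i) \<cdot> T) (T \<cdot> End (S i)) \<and>
        \<tau> i \<bullet> (Unit (S' i) \<rhd> T) = T \<lhd> Unit (S i) \<and>
        \<tau> i \<bullet> (Mult (S' i) \<rhd> T) =
          (T \<lhd> Mult (S i)) \<bullet> (\<tau> i \<rhd> End (S i)) \<bullet> (End (S' i) \<lhd> \<tau> i)) \<and>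
     (\<forall>(i, j)\<in>index_pairs n.
        (\<tau> j \<rhd> End (S i)) \<bullet> (End (S' j) \<lhd> \<tau> i) \<bullet> (l' (i, j) \<rhd> T) =
        (T \<lhd> l (i, j)) \<bullet> (\<tau> i \<rhd> End (S j)) \<bullet> (End (S' i) \<lhd> \<tau> j)))"
  for B (structure)

definition is_tuple2 ::
    "nat \<Rightarrow> ('o, 'a, 'c) two_cat \<Rightarrow> ('o, 'a, 'c) tuple0 \<Rightarrow> ('o, 'a, 'c) tuple0
      \<Rightarrow> ('a, 'c) tuple1 \<Rightarrow> ('a, 'c) tuple1 \<Rightarrow> 'c \<Rightarrow> bool"
  where
  "is_tuple2 n B = (\<lambda>(X, S, l) (X', S', l') (T, \<tau>) (T', \<tau>') \<alpha>.
     \<alpha> \<in> Cell B X X' T T' \<and>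
     (\<forall>i\<in>{1..n}. (\<alpha> \<rhd> End (S i)) \<bullet> \<tau> i = \<tau>' i \<bullet> (End (S' i) \<lhd> \<alpha>)))"
  for B (structure)

definition Mnd_tuples ::
    "nat \<Rightarrow> ('o, 'a, 'c) two_cat \<Rightarrow> (('o, 'a, 'c) tuple0, ('a, 'c) tuple1, 'c) two_cat"
  where
  "Mnd_tuples n B =
    \<lparr>Obj = {x. is_tuple0 n B x},
     Hom = (\<lambda>x x'. {t. is_tuple1 n B x x' t}),
     Cell = (\<lambda>x x' t t'. {\<alpha>. is_tuple2 n B x x' t t' \<alpha>}),
     Id1 = (\<lambda>(X, S, l). (Id1 B X, \<lambda>i\<in>{1..n}. Id2 B (End (S i)))),
     Comp = (\<lambda>(T', \<tau>') (T, \<tau>). (T' \<cdot> T, \<lambda>i\<in>{1..n}. (T' \<lhd> \<tau> i) \<bullet> (\<tau>' i \<rhd> T))),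
     Id2 = (\<lambda>(T, \<tau>). Id2 B T),
     VComp = VComp B,
     HComp = HComp B\<rparr>"
  for B (structure)

section \<open>Re-bracketing\<close>

text \<open>
  The 1-cell \<open>(T, (\<tau>\<^sub>i)\<^sub>i\<^sub>\<le>\<^sub>n)\<close> becomes \<open>((T, (\<tau>\<^sub>i)\<^sub>i\<^sub><\<^sub>n), \<tau>\<^sub>n)\<close>, and the tuple \<open>(X, (S\<^sub>i), (\<lambda>\<^sub>i\<^sub>j))\<close> becomes
  the monad with underlying 1-cell \<open>(S\<^sub>n, (\<lambda>\<^sub>i\<^sub>n)\<^sub>i\<^sub><\<^sub>n)\<close> on the 0-cell given by the data with indices
  below \<open>n\<close>; both recursively. For argument \<open>n\<close> only the entries with indices at most \<open>n\<close> are used.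
\<close>

primrec rebracket1 :: "nat \<Rightarrow> ('a, 'c) tuple1 \<Rightarrow> ('a, 'c) cell1" where
  "rebracket1 0 = (\<lambda>(T, \<tau>). Base1 T)"
| "rebracket1 (Suc n) = (\<lambda>(T, \<tau>). Pair1 (rebracket1 n (T, \<tau>)) (\<tau> (Suc n)))"

primrec rebracket0 :: "nat \<Rightarrow> ('o, 'a, 'c) tuple0 \<Rightarrow> ('o, 'a, 'c) cell0" where
  "rebracket0 0 = (\<lambda>(X, S, l). Base0 X)"
| "rebracket0 (Suc n) = (\<lambda>(X, S, l).
     Pair0 (rebracket0 n (X, S, l))
       (Monad (rebracket1 n (End (S (Suc n)), \<lambda>i. l (i, Suc n)))
          (Unit (S (Suc n))) (Mult (S (Suc n)))))"

end

theory Submission imports Defs begin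

text \<open>
  By induction on \<open>n\<close>, the case \<open>n = 0\<close> being a copy of \<open>B\<close>. In the step,
  a monad in the 2-category of \<open>n\<close>-tuples consists of an endo-1-cell \<open>(T, (\<tau>\<^sub>i))\<close> with unit and
  multiplication. The 1-cell conditions on \<open>\<tau>\<^sub>i = \<lambda>\<^sub>i\<^sub>,\<^sub>n\<^sub>+\<^sub>1\<close> give the half of the distributive law
  concerning \<open>S\<^sub>i\<close> and the Yang-Baxter equations for \<open>i < j < n + 1\<close>; the 2-cell conditions on the unit
  and the multiplication give the half concerning \<open>S\<^sub>n\<^sub>+\<^sub>1\<close>. In a 1-cell \<open>((T, (\<tau>\<^sub>i)), \<tau>\<^sub>n\<^sub>+\<^sub>1)\<close> the condition
  that \<open>\<tau>\<^sub>n\<^sub>+\<^sub>1\<close> is a 2-cell is the compatibility of \<open>\<tau>\<^sub>i\<close> with \<open>\<tau>\<^sub>n\<^sub>+\<^sub>1\<close>. Hence \<open>n + 1\<close>-tuples form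
  the 2-category of monads in \<open>n\<close>-tuples, and \<open>Mnd\<close> preserves isomorphisms.
\<close>

section \<open>Whiskering\<close>

context two_category
begin

text \<open>Cells do not record their boundary, so \<open>arr\<close> and \<open>cell\<close> carry
  it along, together with membership of the endpoints in \<open>Obj B\<close>. The axioms of a
  2-category then become rules whose only premises are typings.\<close>

definition arr :: "'a \<Rightarrow> 'o \<Rightarrow> 'o \<Rightarrow> bool"
  where "arr f X Y \<longleftrightarrow> X \<in> Obj B \<and> Y \<in> Obj B \<and> f \<in> Hom B X Y"

definition cell :: "'c \<Rightarrow> 'o \<Rightarrow> 'o \<Rightarrow> 'a \<Rightarrow> 'a \<Rightarrow> bool"
  where "cell \<alpha> X Y f g \<longleftrightarrow> arr f X Y \<and> arr g X Y \<and> \<alpha> \<in> Cell B X Y f g"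

section \<open>The axioms restated for cells with explicit boundaries, and the calculus of
  whiskering\<close>

lemma arr_Comp: "\<lbrakk>arr f X Y; arr g Y Z\<rbrakk> \<Longrightarrow> arr (g \<cdot> f) X Z"
  using Comp_in_Hom by (auto simp: arr_def)

lemma arr_assoc: "\<lbrakk>arr f W X; arr g X Y; arr h Y Z\<rbrakk> \<Longrightarrow> (h \<cdot> g) \<cdot> f = h \<cdot> (g \<cdot> f)"
  using Comp_assoc by (auto simp: arr_def)

lemma arr_Id1_left: "arr f X Y \<Longrightarrow> Id1 B Y \<cdot> f = f"
  using Comp_Id1_left by (auto simp: arr_def)

lemma arr_Id1_right: "arr f X Y \<Longrightarrow> f \<cdot> Id1 B X = f"
  using Comp_Id1_right by (auto simp: arr_def)

lemma cell_arr: "cell \<alpha> X Y f g \<Longrightarrow> arr f X Y" "cell \<alpha> X Y f g \<Longrightarrow> arr g X Y"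
  by (auto simp: cell_def)

lemma cell_Id2: "arr f X Y \<Longrightarrow> cell (Id2 B f) X Y f f"
  using Id2_in_Cell by (auto simp: cell_def arr_def)

lemma cell_VComp: "\<lbrakk>cell \<alpha> X Y f g; cell \<beta> X Y g h\<rbrakk> \<Longrightarrow> cell (\<beta> \<bullet> \<alpha>) X Y f h"
  using VComp_in_Cell by (auto simp: cell_def arr_def)

lemma cell_HComp:
  "\<lbrakk>cell \<alpha> X Y f f'; cell \<beta> Y Z g g'\<rbrakk> \<Longrightarrow> cell (\<beta> \<star> \<alpha>) X Z (g \<cdot> f) (g' \<cdot> f')"
  using HComp_in_Cell arr_Comp by (auto simp: cell_def arr_def)

lemma cell_left: "\<lbrakk>cell \<alpha> X Y f f'; arr g Y Z\<rbrakk> \<Longrightarrow> cell (g \<lhd> \<alpha>) X Z (g \<cdot> f) (g \<cdot> f')"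
  unfolding whisker_left_def by (intro cell_HComp cell_Id2)

lemma cell_right: "\<lbrakk>arr f X Y; cell \<alpha> Y Z g g'\<rbrakk> \<Longrightarrow> cell (\<alpha> \<rhd> f) X Z (g \<cdot> f) (g' \<cdot> f)"
  unfolding whisker_right_def by (intro cell_HComp cell_Id2)

lemma cell_assoc:
  "\<lbrakk>cell \<alpha> X Y f g; cell \<beta> X Y g h; cell \<gamma> X Y h k\<rbrakk> \<Longrightarrow> (\<gamma> \<bullet> \<beta>) \<bullet> \<alpha> = \<gamma> \<bullet> (\<beta> \<bullet> \<alpha>)"
  using VComp_assoc by (auto simp: cell_def arr_def)

lemma cell_Id2_left: "cell \<alpha> X Y f g \<Longrightarrow> Id2 B g \<bullet> \<alpha> = \<alpha>"
  using VComp_Id2_left by (auto simp: cell_def arr_def)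

lemma cell_Id2_right: "cell \<alpha> X Y f g \<Longrightarrow> \<alpha> \<bullet> Id2 B f = \<alpha>"
  using VComp_Id2_right by (auto simp: cell_def arr_def)

lemma cell_HComp_assoc:
  "\<lbrakk>cell \<alpha> W X f f'; cell \<beta> X Y g g'; cell \<gamma> Y Z h h'\<rbrakk> \<Longrightarrow> (\<gamma> \<star> \<beta>) \<star> \<alpha> = \<gamma> \<star> (\<beta> \<star> \<alpha>)"
  using HComp_assoc by (auto simp: cell_def arr_def)

lemma cell_interchange:
  "\<lbrakk>cell \<alpha> X Y f f'; cell \<alpha>' X Y f' f''; cell \<beta> Y Z g g'; cell \<beta>' Y Z g' g''\<rbrakk>
    \<Longrightarrow> (\<beta>' \<bullet> \<beta>) \<star> (\<alpha>' \<bullet> \<alpha>) = (\<beta>' \<star> \<alpha>') \<bullet> (\<beta> \<star> \<alpha>)"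
  unfolding cell_def arr_def by (elim conjE) (rule interchange)

lemma Id2_Comp: "\<lbrakk>arr f X Y; arr g Y Z\<rbrakk> \<Longrightarrow> Id2 B g \<star> Id2 B f = Id2 B (g \<cdot> f)"
  using HComp_Id2 by (auto simp: arr_def)

lemma left_Id2: "\<lbrakk>arr f X Y; arr g Y Z\<rbrakk> \<Longrightarrow> g \<lhd> Id2 B f = Id2 B (g \<cdot> f)"
  unfolding whisker_left_def by (rule Id2_Comp)

lemma right_Id2: "\<lbrakk>arr f X Y; arr g Y Z\<rbrakk> \<Longrightarrow> Id2 B g \<rhd> f = Id2 B (g \<cdot> f)"
  unfolding whisker_right_def by (rule Id2_Comp)

lemma left_Id1: "cell \<alpha> X Y f g \<Longrightarrow> Id1 B Y \<lhd> \<alpha> = \<alpha>"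
  using HComp_Id_left by (auto simp: cell_def arr_def whisker_left_def)

lemma right_Id1: "cell \<alpha> X Y f g \<Longrightarrow> \<alpha> \<rhd> Id1 B X = \<alpha>"
  using HComp_Id_right by (auto simp: cell_def arr_def whisker_right_def)

text \<open>Interchange with \<open>Id2 B g\<close> in both outer positions;
  \<open>Id2 B g \<bullet> Id2 B g\<close> collapses.\<close>

lemma left_VComp:
  assumes "cell \<alpha> X Y f f'" "cell \<beta> X Y f' f''" "arr g Y Z"
  shows "g \<lhd> (\<beta> \<bullet> \<alpha>) = (g \<lhd> \<beta>) \<bullet> (g \<lhd> \<alpha>)"
  using cell_interchange[OF assms(1,2) cell_Id2 cell_Id2, OF assms(3,3)] assms(3)
  by (simp add: whisker_left_def cell_Id2_left[OF cell_Id2, of g Y Z])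

lemma right_VComp:
  assumes "arr f X Y" "cell \<alpha> Y Z g g'" "cell \<beta> Y Z g' g''"
  shows "(\<beta> \<bullet> \<alpha>) \<rhd> f = (\<beta> \<rhd> f) \<bullet> (\<alpha> \<rhd> f)"
  using cell_interchange[OF cell_Id2 cell_Id2 assms(2,3), OF assms(1,1)] assms(1)
  by (simp add: whisker_right_def cell_Id2_left[OF cell_Id2, of f X Y])

lemma left_left:
  assumes "cell \<alpha> W X f f'" "arr g X Y" "arr h Y Z"
  shows "h \<lhd> (g \<lhd> \<alpha>) = (h \<cdot> g) \<lhd> \<alpha>"
  using cell_HComp_assoc[OF assms(1) assms(2,3)[THEN cell_Id2]]
  by (simp add: whisker_left_def Id2_Comp[OF assms(2,3)])

lemma right_right:
  assumes "arr f W X" "arr g X Y" "cell \<alpha> Y Z h h'"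
  shows "(\<alpha> \<rhd> g) \<rhd> f = \<alpha> \<rhd> (g \<cdot> f)"
  using cell_HComp_assoc[OF assms(1,2)[THEN cell_Id2] assms(3)]
  by (simp add: whisker_right_def Id2_Comp[OF assms(1,2)])

lemma left_right:
  assumes "arr f W X" "cell \<alpha> X Y g g'" "arr h Y Z"
  shows "(h \<lhd> \<alpha>) \<rhd> f = h \<lhd> (\<alpha> \<rhd> f)"
  using cell_HComp_assoc[OF cell_Id2[OF assms(1)] assms(2) cell_Id2[OF assms(3)]]
  by (simp add: whisker_right_def whisker_left_def)

text \<open>Interchange for \<open>\<beta> \<bullet> Id2 B g\<close> and
  \<open>Id2 B f' \<bullet> \<alpha>\<close>: first \<open>\<alpha>\<close>, then
  \<open>\<beta>\<close>. The next lemma takes the opposite order.\<close>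

lemma HComp_right_left:
  assumes "cell \<alpha> X Y f f'" "cell \<beta> Y Z g g'"
  shows "\<beta> \<star> \<alpha> = (\<beta> \<rhd> f') \<bullet> (g \<lhd> \<alpha>)"
  using cell_interchange[OF assms(1) cell_Id2 cell_Id2 assms(2)] assms
  by (simp add: whisker_left_def whisker_right_def cell_Id2_left cell_Id2_right cell_arr)

lemma HComp_left_right:
  assumes "cell \<alpha> X Y f f'" "cell \<beta> Y Z g g'"
  shows "\<beta> \<star> \<alpha> = (g' \<lhd> \<alpha>) \<bullet> (\<beta> \<rhd> f)"
  using cell_interchange[OF cell_Id2 assms(1) assms(2) cell_Id2] assms
  by (simp add: whisker_left_def whisker_right_def cell_Id2_left cell_Id2_right cell_arr)

text \<open>Both composites equal \<open>\<beta> \<star> \<alpha>\<close>. Every later commutation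
  of two 2-cells acting in disjoint positions is an instance.\<close>

lemma whisker_exchange:
  assumes "cell \<alpha> X Y f f'" "cell \<beta> Y Z g g'"
  shows "(\<beta> \<rhd> f') \<bullet> (g \<lhd> \<alpha>) = (g' \<lhd> \<alpha>) \<bullet> (\<beta> \<rhd> f)"
  using HComp_right_left[OF assms] HComp_left_right[OF assms] by simp

section \<open>Monads, identity morphisms and composition of monad morphisms\<close>

lemma monad_cells:
  assumes "X \<in> Obj B" "is_monad B X S"
  shows "arr (End S) X X" "cell (Unit S) X X (Id1 B X) (End S)"
    "cell (Mult S) X X (End S \<cdot> End S) (End S)"
  using assms by (auto simp: is_monad_def arr_def cell_def intro: Id1_in_Hom Comp_in_Hom)

lemma monad_morphism_cells:
  assumes "X \<in> Obj B" "is_monad B X S" "X' \<in> Obj B" "is_monad B X' S'"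
    "is_monad_morphism B (X, S) (X', S') (T, \<tau>)"
  shows "arr T X X'" "cell \<tau> X X' (End S' \<cdot> T) (T \<cdot> End S)"
  using assms by (auto simp: is_monad_morphism_def is_monad_def arr_def cell_def intro: Comp_in_Hom)

lemma monad_morphism_Id:
  assumes X: "X \<in> Obj B" and S: "is_monad B X S"
  shows "is_monad_morphism B (X, S) (X, S) (Id1 B X, Id2 B (End S))"
proof -
  note c = monad_cells[OF X S]
  have SS: "arr (End S \<cdot> End S) X X" by (rule arr_Comp[OF c(1,1)])
  have "Id2 B (End S) \<in> Cell B X X (End S) (End S)"
    using cell_Id2[OF c(1)] by (simp add: cell_def)
  with X show ?thesis
    by (simp add: is_monad_morphism_def arr_Id1_left[OF c(1)] arr_Id1_right[OF c(1)]
        Id1_in_Hom left_Id1[OF c(2)] right_Id1[OF c(2)] left_Id1[OF c(3)] right_Id1[OF c(3)]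
        left_Id2[OF c(1,1)] right_Id2[OF c(1,1)] cell_Id2_left[OF c(2)] cell_Id2_left[OF c(3)]
        cell_Id2_left[OF cell_Id2[OF SS]] cell_Id2_right[OF c(3)])
qed

text \<open>Pasting: the unit and the multiplication of \<open>S''\<close> are pushed first through
  \<open>\<tau>'\<close>, then through \<open>\<tau>\<close>. For the multiplication, the resulting
  factors must be reordered by one exchange of \<open>\<tau>\<close> with
  \<open>\<tau>'\<close>.\<close>

lemma monad_morphism_Comp:
  assumes X: "X \<in> Obj B" and S: "is_monad B X S"
    and X': "X' \<in> Obj B" and S': "is_monad B X' S'"
    and X'': "X'' \<in> Obj B" and S'': "is_monad B X'' S''"
    and T: "is_monad_morphism B (X, S) (X', S') (T, \<tau>)"
    and T': "is_monad_morphism B (X', S') (X'', S'') (T', \<tau>')"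
  shows "is_monad_morphism B (X, S) (X'', S'') (T' \<cdot> T, (T' \<lhd> \<tau>) \<bullet> (\<tau>' \<rhd> T))"
proof -
  note s = monad_cells[OF X S] and s' = monad_cells[OF X' S'] and s'' = monad_cells[OF X'' S'']
  note t = monad_morphism_cells[OF X S X' S' T] and t' = monad_morphism_cells[OF X' S' X'' S'' T']
  note sa = s(1) and sa' = s'(1) and sa'' = s''(1)
  note ta = t(1) and ta' = t'(1)
  have unit: "\<tau> \<bullet> (Unit S' \<rhd> T) = T \<lhd> Unit S" "\<tau>' \<bullet> (Unit S'' \<rhd> T') = T' \<lhd> Unit S'"
    and mult: "\<tau> \<bullet> (Mult S' \<rhd> T) = (T \<lhd> Mult S) \<bullet> (\<tau> \<rhd> End S) \<bullet> (End S' \<lhd> \<tau>)"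
      "\<tau>' \<bullet> (Mult S'' \<rhd> T') = (T' \<lhd> Mult S') \<bullet> (\<tau>' \<rhd> End S') \<bullet> (End S'' \<lhd> \<tau>')"
    using T T' by (auto simp: is_monad_morphism_def)
  \<comment> \<open>These instances bring composites of up to four 1-cells into right-nested form,
    so that the boundaries of consecutive 2-cells below agree literally.\<close>
  note assoc = arr_assoc[OF sa ta ta'] arr_assoc[OF ta sa' ta'] arr_assoc[OF ta ta' sa'']
    arr_assoc[OF sa sa ta] arr_assoc[OF ta sa' sa'] arr_assoc[OF sa' sa' ta'] arr_assoc[OF ta' sa'' sa'']
    arr_assoc[OF sa ta sa'] arr_assoc[OF sa' ta' sa'']
    arr_assoc[OF arr_Comp[OF ta sa'] ta' sa''] arr_assoc[OF arr_Comp[OF sa ta] ta' sa'']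
    arr_assoc[OF arr_Comp[OF ta sa'] sa' ta'] arr_assoc[OF arr_Comp[OF sa ta] sa' ta']
    arr_assoc[OF arr_Comp[OF ta ta'] sa'' sa''] arr_assoc[OF arr_Comp[OF sa sa] ta ta']
  let ?u = "T' \<lhd> \<tau>" and ?v = "\<tau>' \<rhd> T"
  have u: "cell ?u X X'' (T' \<cdot> End S' \<cdot> T) (T' \<cdot> T \<cdot> End S)"
    by (rule cell_left[OF t(2) ta'])
  have v: "cell ?v X X'' (End S'' \<cdot> T' \<cdot> T) (T' \<cdot> End S' \<cdot> T)"
    using cell_right[OF ta t'(2)] by (simp add: assoc)
  have eT: "cell (Unit S'' \<rhd> T' \<cdot> T) X X'' (T' \<cdot> T) (End S'' \<cdot> T' \<cdot> T)"
    using cell_right[OF arr_Comp[OF ta ta'] s''(2)] by (simp add: arr_Id1_left[OF arr_Comp[OF ta ta']])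
  have mT: "cell (Mult S'' \<rhd> T' \<cdot> T) X X'' (End S'' \<cdot> End S'' \<cdot> T' \<cdot> T) (End S'' \<cdot> T' \<cdot> T)"
    using cell_right[OF arr_Comp[OF ta ta'] s''(3)] by (simp add: assoc)
  have m'T': "cell (Mult S'' \<rhd> T') X' X'' (End S'' \<cdot> End S'' \<cdot> T') (End S'' \<cdot> T')"
    using cell_right[OF ta' s''(3)] by (simp add: assoc)
  have e'T': "cell (Unit S'' \<rhd> T') X' X'' T' (End S'' \<cdot> T')"
    using cell_right[OF ta' s''(2)] by (simp add: arr_Id1_left[OF ta'])
  have eS'T: "cell (Unit S' \<rhd> T) X X' T (End S' \<cdot> T)"
    using cell_right[OF ta s'(2)] by (simp add: arr_Id1_left[OF ta])
  have mS'T: "cell (Mult S' \<rhd> T) X X' (End S' \<cdot> End S' \<cdot> T) (End S' \<cdot> T)"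
    using cell_right[OF ta s'(3)] by (simp add: assoc)
  have T'e: "cell (T' \<lhd> Unit S') X' X'' T' (T' \<cdot> End S')"
    using cell_left[OF s'(2) ta'] by (simp add: arr_Id1_right[OF ta'])
  have T'm: "cell (T' \<lhd> Mult S') X' X'' (T' \<cdot> End S' \<cdot> End S') (T' \<cdot> End S')"
    by (rule cell_left[OF s'(3) ta'])
  have unit_eq: "(?u \<bullet> ?v) \<bullet> (Unit S'' \<rhd> T' \<cdot> T) = T' \<cdot> T \<lhd> Unit S"
  proof -
    have "(?u \<bullet> ?v) \<bullet> (Unit S'' \<rhd> T' \<cdot> T) = ?u \<bullet> (?v \<bullet> (Unit S'' \<rhd> T' \<cdot> T))"
      by (rule cell_assoc[OF eT v u])
    also have "?v \<bullet> (Unit S'' \<rhd> T' \<cdot> T) = (T' \<lhd> Unit S') \<rhd> T"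
      by (simp add: right_right[OF ta ta' s''(2), symmetric] right_VComp[OF ta e'T' t'(2), symmetric] unit)
    also have "\<dots> = T' \<lhd> (Unit S' \<rhd> T)"
      by (rule left_right[OF ta s'(2) ta'])
    also have "?u \<bullet> \<dots> = T' \<cdot> T \<lhd> Unit S"
      by (simp add: left_VComp[OF eS'T t(2) ta', symmetric] unit left_left[OF s(2) ta ta'])
    finally show ?thesis .
  qed
  \<comment> \<open>\<open>?a\<close> to \<open>?e\<close>, composed in this order with
    \<open>?e\<close> applied first, are the factors left once both multiplication squares have been
    used; \<open>?c'\<close> and \<open>?d'\<close> are what \<open>?c\<close> and \<open>?d\<close>
    become under the exchange.\<close>
  let ?a = "T' \<cdot> T \<lhd> Mult S" and ?b = "T' \<lhd> (\<tau> \<rhd> End S)" and ?c = "T' \<cdot> End S' \<lhd> \<tau>"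
    and ?d = "\<tau>' \<rhd> End S' \<cdot> T" and ?e = "End S'' \<lhd> (\<tau>' \<rhd> T)"
    and ?c' = "End S'' \<cdot> T' \<lhd> \<tau>" and ?d' = "\<tau>' \<rhd> T \<cdot> End S"
  have tS: "cell (\<tau> \<rhd> End S) X X' (End S' \<cdot> T \<cdot> End S) (T \<cdot> End S \<cdot> End S)"
    using cell_right[OF sa t(2)] by (simp add: assoc)
  have St: "cell (End S' \<lhd> \<tau>) X X' (End S' \<cdot> End S' \<cdot> T) (End S' \<cdot> T \<cdot> End S)"
    by (rule cell_left[OF t(2) sa'])
  have Tm: "cell (T \<lhd> Mult S) X X' (T \<cdot> End S \<cdot> End S) (T \<cdot> End S)"
    by (rule cell_left[OF s(3) ta])
  have t'S: "cell (\<tau>' \<rhd> End S') X' X'' (End S'' \<cdot> T' \<cdot> End S') (T' \<cdot> End S' \<cdot> End S')"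
    using cell_right[OF sa' t'(2)] by (simp add: assoc)
  have St': "cell (End S'' \<lhd> \<tau>') X' X'' (End S'' \<cdot> End S'' \<cdot> T') (End S'' \<cdot> T' \<cdot> End S')"
    by (rule cell_left[OF t'(2) sa''])
  have a: "cell ?a X X'' (T' \<cdot> T \<cdot> End S \<cdot> End S) (T' \<cdot> T \<cdot> End S)"
    using cell_left[OF s(3) arr_Comp[OF ta ta']] by (simp add: assoc)
  have b: "cell ?b X X'' (T' \<cdot> End S' \<cdot> T \<cdot> End S) (T' \<cdot> T \<cdot> End S \<cdot> End S)"
    using cell_left[OF tS ta'] by (simp add: assoc)
  have c: "cell ?c X X'' (T' \<cdot> End S' \<cdot> End S' \<cdot> T) (T' \<cdot> End S' \<cdot> T \<cdot> End S)"
    using cell_left[OF t(2) arr_Comp[OF sa' ta']] by (simp add: assoc)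
  have d: "cell ?d X X'' (End S'' \<cdot> T' \<cdot> End S' \<cdot> T) (T' \<cdot> End S' \<cdot> End S' \<cdot> T)"
    using cell_right[OF arr_Comp[OF ta sa'] t'(2)] by (simp add: assoc)
  have e: "cell ?e X X'' (End S'' \<cdot> End S'' \<cdot> T' \<cdot> T) (End S'' \<cdot> T' \<cdot> End S' \<cdot> T)"
    using cell_left[OF v sa''] by (simp add: assoc)
  have c': "cell ?c' X X'' (End S'' \<cdot> T' \<cdot> End S' \<cdot> T) (End S'' \<cdot> T' \<cdot> T \<cdot> End S)"
    using cell_left[OF t(2) arr_Comp[OF ta' sa'']] by (simp add: assoc)
  have d': "cell ?d' X X'' (End S'' \<cdot> T' \<cdot> T \<cdot> End S) (T' \<cdot> End S' \<cdot> T \<cdot> End S)"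
    using cell_right[OF arr_Comp[OF sa ta] t'(2)] by (simp add: assoc)
  have mult_eq: "(?u \<bullet> ?v) \<bullet> (Mult S'' \<rhd> T' \<cdot> T)
    = ?a \<bullet> ((?u \<bullet> ?v) \<rhd> End S) \<bullet> (End S'' \<lhd> (?u \<bullet> ?v))"
  proof -
    have v_mult: "?v \<bullet> (Mult S'' \<rhd> T' \<cdot> T) = (T' \<lhd> (Mult S' \<rhd> T)) \<bullet> ?d \<bullet> ?e"
      by (simp add: right_right[OF ta ta' s''(3), symmetric] right_VComp[OF ta m'T' t'(2), symmetric]
          mult right_VComp[OF ta cell_VComp[OF St' t'S] T'm] right_VComp[OF ta St' t'S]
          left_right[OF ta s'(3) ta'] right_right[OF ta sa' t'(2)] left_right[OF ta t'(2) sa''])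
    have u_mult: "?u \<bullet> (T' \<lhd> (Mult S' \<rhd> T)) = ?a \<bullet> ?b \<bullet> ?c"
      by (simp add: left_VComp[OF mS'T t(2) ta', symmetric] mult
          left_VComp[OF cell_VComp[OF St tS] Tm ta'] left_VComp[OF St tS ta']
          left_left[OF s(3) ta ta'] left_left[OF t(2) sa' ta'])
    have T'mT: "cell (T' \<lhd> (Mult S' \<rhd> T)) X X'' (T' \<cdot> End S' \<cdot> End S' \<cdot> T) (T' \<cdot> End S' \<cdot> T)"
      by (rule cell_left[OF mS'T ta'])
    have "(?u \<bullet> ?v) \<bullet> (Mult S'' \<rhd> T' \<cdot> T) = ?u \<bullet> (T' \<lhd> (Mult S' \<rhd> T)) \<bullet> ?d \<bullet> ?e"
      by (simp add: cell_assoc[OF mT v u] v_mult)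
    also have "\<dots> = (?a \<bullet> ?b \<bullet> ?c) \<bullet> ?d \<bullet> ?e"
      by (simp add: cell_assoc[OF cell_VComp[OF e d] T'mT u, symmetric] u_mult)
    also have "\<dots> = ?a \<bullet> ?b \<bullet> (?c \<bullet> ?d) \<bullet> ?e"
      by (simp add: cell_assoc[OF cell_VComp[OF e d] cell_VComp[OF c b] a]
          cell_assoc[OF cell_VComp[OF e d] c b] cell_assoc[OF e d c])
    \<comment> \<open>Swapping \<open>\<tau>\<close> and \<open>\<tau>'\<close> puts
      \<open>?b\<close> next to \<open>?d'\<close> and \<open>?c'\<close> next to \<open>?e\<close>;
      each of these pairs is a whiskering of \<open>?u \<bullet> ?v\<close>.\<close>
    also have "?c \<bullet> ?d = ?d' \<bullet> ?c'"
      using whisker_exchange[OF t(2) t'(2)] by simp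
    also have "?a \<bullet> ?b \<bullet> (?d' \<bullet> ?c') \<bullet> ?e = ?a \<bullet> (?b \<bullet> ?d') \<bullet> (?c' \<bullet> ?e)"
      by (simp add: cell_assoc[OF e c' d'] cell_assoc[OF cell_VComp[OF e c'] d' b])
    also have "?b \<bullet> ?d' = (?u \<bullet> ?v) \<rhd> End S"
      by (simp add: right_VComp[OF sa v u] left_right[OF sa t(2) ta'] right_right[OF sa ta t'(2)])
    also have "?c' \<bullet> ?e = End S'' \<lhd> (?u \<bullet> ?v)"
      by (simp add: left_VComp[OF v u sa''] left_left[OF t(2) ta' sa''])
    finally show ?thesis .
  qed
  show ?thesis
    using arr_Comp[OF ta ta'] cell_VComp[OF v u] unit_eq mult_eq
    by (simp add: is_monad_morphism_def arr_def cell_def assoc)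
qed

end

section \<open>\<open>Mnd(B)\<close> is a 2-category\<close>

lemma whisker_Mnd [simp]:
  "whisker_left (Mnd B) (T, \<tau>) \<alpha> = whisker_left B T \<alpha>"
  "whisker_right (Mnd B) \<alpha> (T, \<tau>) = whisker_right B \<alpha> T"
  by (simp_all add: whisker_left_def whisker_right_def Mnd_def)

lemma VComp_Mnd [simp]: "VComp (Mnd B) = VComp B" and HComp_Mnd [simp]: "HComp (Mnd B) = HComp B"
  by (simp_all add: Mnd_def)

text \<open>The forgetful 2-functor from \<open>Mnd B\<close> to \<open>B\<close> is
  \<open>fst\<close> on 0-cells and 1-cells and the identity on 2-cells. Hence an axiom of
  \<open>Mnd B\<close> that equates 2-cells is an instance of the same axiom in
  \<open>B\<close>.\<close>

lemma fst_Mnd: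
  "X \<in> Obj (Mnd B) \<Longrightarrow> fst X \<in> Obj B"
  "f \<in> Hom (Mnd B) X Y \<Longrightarrow> fst f \<in> Hom B (fst X) (fst Y)"
  "\<alpha> \<in> Cell (Mnd B) X Y f g \<Longrightarrow> \<alpha> \<in> Cell B (fst X) (fst Y) (fst f) (fst g)"
  "Id2 (Mnd B) f = Id2 B (fst f)"
  "fst (Comp (Mnd B) g f) = Comp B (fst g) (fst f)"
  "fst (Id1 (Mnd B) X) = Id1 B (fst X)"
  by (auto simp: Mnd_def is_monad_morphism_def is_monad_2cell_def split: prod.splits)

context two_category
begin

section \<open>Closure of the 2-cells between monad morphisms under the operations\<close>

lemma monad_2cell_cells:
  assumes "is_monad_2cell B (X, S) (X', S') (T, \<tau>) (U, \<sigma>) \<alpha>" "arr T X X'" "arr U X X'"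
  shows "cell \<alpha> X X' T U"
  using assms by (simp add: is_monad_2cell_def cell_def)

lemma monad_2cell_Id2:
  assumes X: "X \<in> Obj B" and S: "is_monad B X S" and X': "X' \<in> Obj B" and S': "is_monad B X' S'"
    and T: "is_monad_morphism B (X, S) (X', S') (T, \<tau>)"
  shows "is_monad_2cell B (X, S) (X', S') (T, \<tau>) (T, \<tau>) (Id2 B T)"
proof -
  note s = monad_cells(1)[OF X S] and s' = monad_cells(1)[OF X' S']
  note t = monad_morphism_cells[OF X S X' S' T]
  show ?thesis
    using cell_Id2[OF t(1)]
    by (simp add: is_monad_2cell_def right_Id2[OF s t(1)] left_Id2[OF t(1) s']
        cell_Id2_left[OF t(2)] cell_Id2_right[OF t(2)] cell_def)
qed

text \<open>The two compatibility squares are stacked along \<open>\<sigma>\<close>.\<close>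

lemma monad_2cell_VComp:
  assumes X: "X \<in> Obj B" and S: "is_monad B X S" and X': "X' \<in> Obj B" and S': "is_monad B X' S'"
    and T: "is_monad_morphism B (X, S) (X', S') (T, \<tau>)"
    and U: "is_monad_morphism B (X, S) (X', S') (U, \<sigma>)"
    and V: "is_monad_morphism B (X, S) (X', S') (V, \<rho>)"
    and \<alpha>: "is_monad_2cell B (X, S) (X', S') (T, \<tau>) (U, \<sigma>) \<alpha>"
    and \<beta>: "is_monad_2cell B (X, S) (X', S') (U, \<sigma>) (V, \<rho>) \<beta>"
  shows "is_monad_2cell B (X, S) (X', S') (T, \<tau>) (V, \<rho>) (\<beta> \<bullet> \<alpha>)"
proof -
  note s = monad_cells(1)[OF X S] and s' = monad_cells(1)[OF X' S']
  note t = monad_morphism_cells[OF X S X' S' T] and u = monad_morphism_cells[OF X S X' S' U]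
    and v = monad_morphism_cells[OF X S X' S' V]
  note a = monad_2cell_cells[OF \<alpha> t(1) u(1)] and b = monad_2cell_cells[OF \<beta> u(1) v(1)]
  have eq: "(\<alpha> \<rhd> End S) \<bullet> \<tau> = \<sigma> \<bullet> (End S' \<lhd> \<alpha>)" "(\<beta> \<rhd> End S) \<bullet> \<sigma> = \<rho> \<bullet> (End S' \<lhd> \<beta>)"
    using \<alpha> \<beta> by (auto simp: is_monad_2cell_def)
  have "((\<beta> \<bullet> \<alpha>) \<rhd> End S) \<bullet> \<tau> = (\<beta> \<rhd> End S) \<bullet> \<sigma> \<bullet> (End S' \<lhd> \<alpha>)"
    by (simp add: right_VComp[OF s a b] cell_assoc[OF t(2) cell_right[OF s a] cell_right[OF s b]] eq)
  also have "\<dots> = (\<rho> \<bullet> (End S' \<lhd> \<beta>)) \<bullet> (End S' \<lhd> \<alpha>)"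
    by (simp add: cell_assoc[OF cell_left[OF a s'] u(2) cell_right[OF s b], symmetric] eq)
  also have "\<dots> = \<rho> \<bullet> (End S' \<lhd> (\<beta> \<bullet> \<alpha>))"
    by (simp add: left_VComp[OF a b s'] cell_assoc[OF cell_left[OF a s'] cell_left[OF b s'] v(2)])
  finally show ?thesis
    using cell_VComp[OF a b] by (simp add: is_monad_2cell_def cell_def)
qed

text \<open>Write \<open>\<beta> \<star> \<alpha>\<close> as \<open>\<beta> \<rhd> U\<close> after
  \<open>T' \<lhd> \<alpha>\<close>. The square of \<open>\<alpha>\<close> carries it past
  \<open>\<tau>\<close>, the square of \<open>\<beta>\<close> carries it past
  \<open>\<tau>'\<close>, and exchanges in between bring the factors together.\<close>

lemma monad_2cell_HComp:
  assumes X: "X \<in> Obj B" and S: "is_monad B X S"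
    and X': "X' \<in> Obj B" and S': "is_monad B X' S'"
    and X'': "X'' \<in> Obj B" and S'': "is_monad B X'' S''"
    and T: "is_monad_morphism B (X, S) (X', S') (T, \<tau>)"
    and U: "is_monad_morphism B (X, S) (X', S') (U, \<sigma>)"
    and T': "is_monad_morphism B (X', S') (X'', S'') (T', \<tau>')"
    and U': "is_monad_morphism B (X', S') (X'', S'') (U', \<sigma>')"
    and \<alpha>: "is_monad_2cell B (X, S) (X', S') (T, \<tau>) (U, \<sigma>) \<alpha>"
    and \<beta>: "is_monad_2cell B (X', S') (X'', S'') (T', \<tau>') (U', \<sigma>') \<beta>"
  shows "is_monad_2cell B (X, S) (X'', S'') (T' \<cdot> T, (T' \<lhd> \<tau>) \<bullet> (\<tau>' \<rhd> T))
    (U' \<cdot> U, (U' \<lhd> \<sigma>) \<bullet> (\<sigma>' \<rhd> U)) (\<beta> \<star> \<alpha>)"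
proof -
  note s = monad_cells(1)[OF X S] and s' = monad_cells(1)[OF X' S']
    and s'' = monad_cells(1)[OF X'' S'']
  note t = monad_morphism_cells[OF X S X' S' T] and u = monad_morphism_cells[OF X S X' S' U]
    and t' = monad_morphism_cells[OF X' S' X'' S'' T'] and u' = monad_morphism_cells[OF X' S' X'' S'' U']
  note a = monad_2cell_cells[OF \<alpha> t(1) u(1)] and b = monad_2cell_cells[OF \<beta> t'(1) u'(1)]
  have eq: "(\<alpha> \<rhd> End S) \<bullet> \<tau> = \<sigma> \<bullet> (End S' \<lhd> \<alpha>)"
      "(\<beta> \<rhd> End S') \<bullet> \<tau>' = \<sigma>' \<bullet> (End S'' \<lhd> \<beta>)"
    using \<alpha> \<beta> by (auto simp: is_monad_2cell_def)
  note assoc = arr_assoc[OF s t(1) t'(1)] arr_assoc[OF s u(1) u'(1)] arr_assoc[OF s u(1) t'(1)]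
    arr_assoc[OF t(1) s' t'(1)] arr_assoc[OF u(1) s' t'(1)] arr_assoc[OF u(1) s' u'(1)]
    arr_assoc[OF t(1) t'(1) s''] arr_assoc[OF u(1) t'(1) s''] arr_assoc[OF u(1) u'(1) s'']
  have T'a: "cell (T' \<lhd> \<alpha>) X X'' (T' \<cdot> T) (T' \<cdot> U)"
    by (rule cell_left[OF a t'(1)])
  have bU: "cell (\<beta> \<rhd> U) X X'' (T' \<cdot> U) (U' \<cdot> U)"
    by (rule cell_right[OF u(1) b])
  have T't: "cell (T' \<lhd> \<tau>) X X'' (T' \<cdot> End S' \<cdot> T) (T' \<cdot> T \<cdot> End S)"
    by (rule cell_left[OF t(2) t'(1)])
  have t'T: "cell (\<tau>' \<rhd> T) X X'' (End S'' \<cdot> T' \<cdot> T) (T' \<cdot> End S' \<cdot> T)"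
    using cell_right[OF t(1) t'(2)] by (simp add: assoc)
  have t'U: "cell (\<tau>' \<rhd> U) X X'' (End S'' \<cdot> T' \<cdot> U) (T' \<cdot> End S' \<cdot> U)"
    using cell_right[OF u(1) t'(2)] by (simp add: assoc)
  have u'U: "cell (\<sigma>' \<rhd> U) X X'' (End S'' \<cdot> U' \<cdot> U) (U' \<cdot> End S' \<cdot> U)"
    using cell_right[OF u(1) u'(2)] by (simp add: assoc)
  have T'u: "cell (T' \<lhd> \<sigma>) X X'' (T' \<cdot> End S' \<cdot> U) (T' \<cdot> U \<cdot> End S)"
    by (rule cell_left[OF u(2) t'(1)])
  have U'u: "cell (U' \<lhd> \<sigma>) X X'' (U' \<cdot> End S' \<cdot> U) (U' \<cdot> U \<cdot> End S)"
    by (rule cell_left[OF u(2) u'(1)])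
  have aS: "cell (\<alpha> \<rhd> End S) X X' (T \<cdot> End S) (U \<cdot> End S)"
    by (rule cell_right[OF s a])
  have Sa: "cell (End S' \<lhd> \<alpha>) X X' (End S' \<cdot> T) (End S' \<cdot> U)"
    by (rule cell_left[OF a s'])
  have Sb: "cell (End S'' \<lhd> \<beta>) X' X'' (End S'' \<cdot> T') (End S'' \<cdot> U')"
    by (rule cell_left[OF b s''])
  have bS: "cell (\<beta> \<rhd> End S') X' X'' (T' \<cdot> End S') (U' \<cdot> End S')"
    by (rule cell_right[OF s' b])
  have T'aS: "cell (T' \<lhd> (\<alpha> \<rhd> End S)) X X'' (T' \<cdot> T \<cdot> End S) (T' \<cdot> U \<cdot> End S)"
    by (rule cell_left[OF aS t'(1)])
  have bUS: "cell (\<beta> \<rhd> U \<cdot> End S) X X'' (T' \<cdot> U \<cdot> End S) (U' \<cdot> U \<cdot> End S)"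
    by (rule cell_right[OF arr_Comp[OF s u(1)] b])
  have bSU: "cell (\<beta> \<rhd> End S' \<cdot> U) X X'' (T' \<cdot> End S' \<cdot> U) (U' \<cdot> End S' \<cdot> U)"
    by (rule cell_right[OF arr_Comp[OF u(1) s'] b])
  have T'Sa: "cell (T' \<cdot> End S' \<lhd> \<alpha>) X X'' (T' \<cdot> End S' \<cdot> T) (T' \<cdot> End S' \<cdot> U)"
    using cell_left[OF a arr_Comp[OF s' t'(1)]] by (simp add: assoc)
  have ST'a: "cell (End S'' \<cdot> T' \<lhd> \<alpha>) X X'' (End S'' \<cdot> T' \<cdot> T) (End S'' \<cdot> T' \<cdot> U)"
    using cell_left[OF a arr_Comp[OF t'(1) s'']] by (simp add: assoc)
  have SbU: "cell (End S'' \<lhd> (\<beta> \<rhd> U)) X X'' (End S'' \<cdot> T' \<cdot> U) (End S'' \<cdot> U' \<cdot> U)"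
    by (rule cell_left[OF bU s''])
  have "((\<beta> \<star> \<alpha>) \<rhd> End S) \<bullet> (T' \<lhd> \<tau>) \<bullet> (\<tau>' \<rhd> T)
    = (\<beta> \<rhd> U \<cdot> End S) \<bullet> ((T' \<lhd> (\<alpha> \<rhd> End S)) \<bullet> (T' \<lhd> \<tau>)) \<bullet> (\<tau>' \<rhd> T)"
    by (simp add: HComp_right_left[OF a b] right_VComp[OF s T'a bU] right_right[OF s u(1) b]
        left_right[OF s a t'(1)] cell_assoc[OF cell_VComp[OF t'T T't] T'aS bUS]
        cell_assoc[OF t'T T't T'aS])
  also have "(T' \<lhd> (\<alpha> \<rhd> End S)) \<bullet> (T' \<lhd> \<tau>) = (T' \<lhd> \<sigma>) \<bullet> (T' \<cdot> End S' \<lhd> \<alpha>)"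
    by (simp add: left_VComp[OF t(2) aS t'(1), symmetric] eq left_VComp[OF Sa u(2) t'(1)]
        left_left[OF a s' t'(1)])
  also have "(\<beta> \<rhd> U \<cdot> End S) \<bullet> ((T' \<lhd> \<sigma>) \<bullet> (T' \<cdot> End S' \<lhd> \<alpha>)) \<bullet> (\<tau>' \<rhd> T)
    = ((\<beta> \<rhd> U \<cdot> End S) \<bullet> (T' \<lhd> \<sigma>)) \<bullet> (T' \<cdot> End S' \<lhd> \<alpha>) \<bullet> (\<tau>' \<rhd> T)"
    by (simp add: cell_assoc[OF t'T T'Sa T'u] cell_assoc[OF cell_VComp[OF t'T T'Sa] T'u bUS])
  \<comment> \<open>Two exchanges: \<open>\<alpha>\<close> passes \<open>\<tau>'\<close> and
    \<open>\<beta>\<close> passes \<open>\<sigma>\<close>. Only then does \<open>\<beta>\<close>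
    meet \<open>\<tau>'\<close>, where its own square applies.\<close>
  also have "(T' \<cdot> End S' \<lhd> \<alpha>) \<bullet> (\<tau>' \<rhd> T) = (\<tau>' \<rhd> U) \<bullet> (End S'' \<cdot> T' \<lhd> \<alpha>)"
    by (rule whisker_exchange[OF a t'(2), symmetric])
  also have "(\<beta> \<rhd> U \<cdot> End S) \<bullet> (T' \<lhd> \<sigma>) = (U' \<lhd> \<sigma>) \<bullet> (\<beta> \<rhd> End S' \<cdot> U)"
    by (rule whisker_exchange[OF u(2) b])
  also have "((U' \<lhd> \<sigma>) \<bullet> (\<beta> \<rhd> End S' \<cdot> U)) \<bullet> (\<tau>' \<rhd> U) \<bullet> (End S'' \<cdot> T' \<lhd> \<alpha>)
    = (U' \<lhd> \<sigma>) \<bullet> ((\<beta> \<rhd> End S' \<cdot> U) \<bullet> (\<tau>' \<rhd> U)) \<bullet> (End S'' \<cdot> T' \<lhd> \<alpha>)"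
    by (simp add: cell_assoc[OF ST'a t'U bSU] cell_assoc[OF cell_VComp[OF ST'a t'U] bSU U'u])
  also have "(\<beta> \<rhd> End S' \<cdot> U) \<bullet> (\<tau>' \<rhd> U) = (\<sigma>' \<rhd> U) \<bullet> (End S'' \<lhd> (\<beta> \<rhd> U))"
    by (simp add: right_right[OF u(1) s' b, symmetric] right_VComp[OF u(1) t'(2) bS, symmetric] eq
        right_VComp[OF u(1) Sb u'(2)] left_right[OF u(1) b s''])
  also have "(U' \<lhd> \<sigma>) \<bullet> ((\<sigma>' \<rhd> U) \<bullet> (End S'' \<lhd> (\<beta> \<rhd> U))) \<bullet> (End S'' \<cdot> T' \<lhd> \<alpha>)
    = ((U' \<lhd> \<sigma>) \<bullet> (\<sigma>' \<rhd> U)) \<bullet> (End S'' \<lhd> (\<beta> \<star> \<alpha>))"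
    by (simp add: HComp_right_left[OF a b] left_VComp[OF T'a bU s''] left_left[OF a t'(1) s'']
        cell_assoc[OF ST'a SbU u'U] cell_assoc[OF cell_VComp[OF ST'a SbU] u'U U'u])
  finally show ?thesis
    using cell_HComp[OF a b] by (simp add: is_monad_2cell_def cell_def)
qed

text \<open>Both sides expand to the same three factors, one for each of \<open>\<tau>\<close>,
  \<open>\<tau>'\<close>, \<open>\<tau>''\<close>. This is the second component of associativity of
  1-cell composition in \<open>Mnd B\<close>.\<close>

lemma monad_morphism_Comp_assoc:
  assumes X: "X \<in> Obj B" and S: "is_monad B X S"
    and X': "X' \<in> Obj B" and S': "is_monad B X' S'"
    and X'': "X'' \<in> Obj B" and S'': "is_monad B X'' S''"
    and X''': "X''' \<in> Obj B" and S''': "is_monad B X''' S'''"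
    and T: "is_monad_morphism B (X, S) (X', S') (T, \<tau>)"
    and T': "is_monad_morphism B (X', S') (X'', S'') (T', \<tau>')"
    and T'': "is_monad_morphism B (X'', S'') (X''', S''') (T'', \<tau>'')"
  shows "(T'' \<cdot> T' \<lhd> \<tau>) \<bullet> (((T'' \<lhd> \<tau>') \<bullet> (\<tau>'' \<rhd> T')) \<rhd> T)
    = (T'' \<lhd> ((T' \<lhd> \<tau>) \<bullet> (\<tau>' \<rhd> T))) \<bullet> (\<tau>'' \<rhd> T' \<cdot> T)"
proof -
  note s = monad_cells(1)[OF X S] and s' = monad_cells(1)[OF X' S']
    and s'' = monad_cells(1)[OF X'' S''] and s''' = monad_cells(1)[OF X''' S''']
  note t = monad_morphism_cells[OF X S X' S' T] and t' = monad_morphism_cells[OF X' S' X'' S'' T']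
    and t'' = monad_morphism_cells[OF X'' S'' X''' S''' T'']
  note assoc = arr_assoc[OF t(1) s' t'(1)] arr_assoc[OF t(1) t'(1) s'']
    arr_assoc[OF t'(1) s'' t''(1)] arr_assoc[OF t'(1) t''(1) s''']
    arr_assoc[OF arr_Comp[OF t(1) t'(1)] s'' t''(1)]
  have t'T: "cell (\<tau>' \<rhd> T) X X'' (End S'' \<cdot> T' \<cdot> T) (T' \<cdot> End S' \<cdot> T)"
    using cell_right[OF t(1) t'(2)] by (simp add: assoc)
  have T't: "cell (T' \<lhd> \<tau>) X X'' (T' \<cdot> End S' \<cdot> T) (T' \<cdot> T \<cdot> End S)"
    by (rule cell_left[OF t(2) t'(1)])
  have T''t': "cell (T'' \<lhd> \<tau>') X' X''' (T'' \<cdot> End S'' \<cdot> T') (T'' \<cdot> T' \<cdot> End S')"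
    by (rule cell_left[OF t'(2) t''(1)])
  have t''T': "cell (\<tau>'' \<rhd> T') X' X''' (End S''' \<cdot> T'' \<cdot> T') (T'' \<cdot> End S'' \<cdot> T')"
    using cell_right[OF t'(1) t''(2)] by (simp add: assoc)
  have t''T'T: "cell (\<tau>'' \<rhd> T' \<cdot> T) X X''' ((End S''' \<cdot> T'') \<cdot> T' \<cdot> T) (T'' \<cdot> End S'' \<cdot> T' \<cdot> T)"
    using cell_right[OF arr_Comp[OF t(1) t'(1)] t''(2)] by (simp add: assoc)
  show ?thesis
    by (simp add: left_VComp[OF t'T T't t''(1)] right_VComp[OF t(1) t''T' T''t']
        left_left[OF t(2) t'(1) t''(1)] left_right[OF t(1) t'(2) t''(1)]
        right_right[OF t(1) t'(1) t''(2)]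
        cell_assoc[OF t''T'T cell_left[OF t'T t''(1)] cell_left[OF T't t''(1), simplified left_left[OF t(2) t'(1) t''(1)]]])
qed

text \<open>The closure conditions and the laws of 1-cell composition rest on the pasting arguments
  and unit laws above; the equations between 2-cells are inherited through
  \<open>fst_Mnd\<close>.\<close>

theorem two_category_Mnd: "two_category (Mnd B)"
proof
  fix X assume "X \<in> Obj (Mnd B)"
  then show "Id1 (Mnd B) X \<in> Hom (Mnd B) X X"
    using monad_morphism_Id by (auto simp: Mnd_def)
next
  fix X Y Z f g
  assume "X \<in> Obj (Mnd B)" "Y \<in> Obj (Mnd B)" "Z \<in> Obj (Mnd B)" "f \<in> Hom (Mnd B) X Y"
    "g \<in> Hom (Mnd B) Y Z"
  then show "g \<cdot>\<^bsub>Mnd B\<^esub> f \<in> Hom (Mnd B) X Z"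
    using monad_morphism_Comp by (cases f; cases g) (auto simp: Mnd_def)
next
  fix W X Y Z f g h
  assume a: "W \<in> Obj (Mnd B)" "X \<in> Obj (Mnd B)" "Y \<in> Obj (Mnd B)" "Z \<in> Obj (Mnd B)"
    "f \<in> Hom (Mnd B) W X" "g \<in> Hom (Mnd B) X Y" "h \<in> Hom (Mnd B) Y Z"
  obtain W0 P X0 Q Y0 R Z0 S f0 f1 g0 g1 h0 h1 where
    [simp]: "W = (W0, P)" "X = (X0, Q)" "Y = (Y0, R)" "Z = (Z0, S)" "f = (f0, f1)" "g = (g0, g1)" "h = (h0, h1)"
    by (metis surj_pair)
  have "(h0 \<cdot> g0) \<cdot> f0 = h0 \<cdot> g0 \<cdot> f0"
    by (rule arr_assoc[of _ W0 X0 _ Y0 _ Z0]) (use a in \<open>auto simp: Mnd_def is_monad_morphism_def arr_def\<close>)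
  moreover have "(h0 \<cdot> g0 \<lhd> f1) \<bullet> (((h0 \<lhd> g1) \<bullet> (h1 \<rhd> g0)) \<rhd> f0)
    = (h0 \<lhd> ((g0 \<lhd> f1) \<bullet> (g1 \<rhd> f0))) \<bullet> (h1 \<rhd> g0 \<cdot> f0)"
    by (rule monad_morphism_Comp_assoc[of W0 P X0 Q Y0 R Z0 S]) (use a in \<open>auto simp: Mnd_def\<close>)
  ultimately show "(h \<cdot>\<^bsub>Mnd B\<^esub> g) \<cdot>\<^bsub>Mnd B\<^esub> f = h \<cdot>\<^bsub>Mnd B\<^esub> g \<cdot>\<^bsub>Mnd B\<^esub> f"
    by (simp add: Mnd_def)
next
  fix X Y f
  assume a: "X \<in> Obj (Mnd B)" "Y \<in> Obj (Mnd B)" "f \<in> Hom (Mnd B) X Y"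
  obtain X0 S Y0 S' T \<tau> where [simp]: "X = (X0, S)" "Y = (Y0, S')" "f = (T, \<tau>)"
    by (metis surj_pair)
  have s: "arr (End S) X0 X0" "arr (End S') Y0 Y0" and t: "arr T X0 Y0" "cell \<tau> X0 Y0 (End S' \<cdot> T) (T \<cdot> End S)"
    using a monad_morphism_cells[of X0 S Y0 S' T \<tau>] monad_cells(1) by (auto simp: Mnd_def)
  show "Id1 (Mnd B) Y \<cdot>\<^bsub>Mnd B\<^esub> f = f"
    by (simp add: Mnd_def arr_Id1_left[OF t(1)] left_Id1[OF t(2)] right_Id2[OF t(1) s(2)] cell_Id2_right[OF t(2)])
  show "f \<cdot>\<^bsub>Mnd B\<^esub> Id1 (Mnd B) X = f"
    by (simp add: Mnd_def arr_Id1_right[OF t(1)] right_Id1[OF t(2)] left_Id2[OF s(1) t(1)] cell_Id2_left[OF t(2)])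
  show "Id2 (Mnd B) f \<in> Cell (Mnd B) X Y f f"
    using a monad_2cell_Id2 by (auto simp: Mnd_def)
next
  fix X Y f g h \<alpha> \<beta>
  assume "X \<in> Obj (Mnd B)" "Y \<in> Obj (Mnd B)" "f \<in> Hom (Mnd B) X Y" "g \<in> Hom (Mnd B) X Y"
    "h \<in> Hom (Mnd B) X Y" "\<alpha> \<in> Cell (Mnd B) X Y f g" "\<beta> \<in> Cell (Mnd B) X Y g h"
  then show "\<beta> \<bullet>\<^bsub>Mnd B\<^esub> \<alpha> \<in> Cell (Mnd B) X Y f h"
    using monad_2cell_VComp by (cases f; cases g; cases h) (auto simp: Mnd_def)
next
  fix X Y Z f f' g g' \<alpha> \<beta>
  assume "X \<in> Obj (Mnd B)" "Y \<in> Obj (Mnd B)" "Z \<in> Obj (Mnd B)"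
    "f \<in> Hom (Mnd B) X Y" "f' \<in> Hom (Mnd B) X Y" "g \<in> Hom (Mnd B) Y Z" "g' \<in> Hom (Mnd B) Y Z"
    "\<alpha> \<in> Cell (Mnd B) X Y f f'" "\<beta> \<in> Cell (Mnd B) Y Z g g'"
  then show "\<beta> \<star>\<^bsub>Mnd B\<^esub> \<alpha> \<in> Cell (Mnd B) X Z (g \<cdot>\<^bsub>Mnd B\<^esub> f) (g' \<cdot>\<^bsub>Mnd B\<^esub> f')"
    using monad_2cell_HComp by (cases f; cases f'; cases g; cases g') (auto simp: Mnd_def)
next
  fix X Y f g h k \<alpha> \<beta> \<gamma>
  assume "X \<in> Obj (Mnd B)" "Y \<in> Obj (Mnd B)" "f \<in> Hom (Mnd B) X Y" "g \<in> Hom (Mnd B) X Y"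
    "h \<in> Hom (Mnd B) X Y" "k \<in> Hom (Mnd B) X Y"
    "\<alpha> \<in> Cell (Mnd B) X Y f g" "\<beta> \<in> Cell (Mnd B) X Y g h" "\<gamma> \<in> Cell (Mnd B) X Y h k"
  then show "(\<gamma> \<bullet>\<^bsub>Mnd B\<^esub> \<beta>) \<bullet>\<^bsub>Mnd B\<^esub> \<alpha> = \<gamma> \<bullet>\<^bsub>Mnd B\<^esub> \<beta> \<bullet>\<^bsub>Mnd B\<^esub> \<alpha>"
    using VComp_assoc[of "fst X" "fst Y" "fst f" "fst g" "fst h" "fst k" \<alpha> \<beta> \<gamma>]
    by (simp add: fst_Mnd)
next
  fix X Y f g \<alpha>
  assume "X \<in> Obj (Mnd B)" "Y \<in> Obj (Mnd B)" "f \<in> Hom (Mnd B) X Y" "g \<in> Hom (Mnd B) X Y"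
    "\<alpha> \<in> Cell (Mnd B) X Y f g"
  then show "Id2 (Mnd B) g \<bullet>\<^bsub>Mnd B\<^esub> \<alpha> = \<alpha>" "\<alpha> \<bullet>\<^bsub>Mnd B\<^esub> Id2 (Mnd B) f = \<alpha>"
    "Id2 (Mnd B) (Id1 (Mnd B) Y) \<star>\<^bsub>Mnd B\<^esub> \<alpha> = \<alpha>" "\<alpha> \<star>\<^bsub>Mnd B\<^esub> Id2 (Mnd B) (Id1 (Mnd B) X) = \<alpha>"
    using VComp_Id2_left[of "fst X" "fst Y" "fst f" "fst g" \<alpha>]
      VComp_Id2_right[of "fst X" "fst Y" "fst f" "fst g" \<alpha>]
      HComp_Id_left[of "fst X" "fst Y" "fst f" "fst g" \<alpha>]
      HComp_Id_right[of "fst X" "fst Y" "fst f" "fst g" \<alpha>]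
    by (simp_all add: fst_Mnd)
next
  fix W X Y Z f f' g g' h h' \<alpha> \<beta> \<gamma>
  assume "W \<in> Obj (Mnd B)" "X \<in> Obj (Mnd B)" "Y \<in> Obj (Mnd B)" "Z \<in> Obj (Mnd B)"
    "f \<in> Hom (Mnd B) W X" "f' \<in> Hom (Mnd B) W X" "g \<in> Hom (Mnd B) X Y" "g' \<in> Hom (Mnd B) X Y"
    "h \<in> Hom (Mnd B) Y Z" "h' \<in> Hom (Mnd B) Y Z"
    "\<alpha> \<in> Cell (Mnd B) W X f f'" "\<beta> \<in> Cell (Mnd B) X Y g g'" "\<gamma> \<in> Cell (Mnd B) Y Z h h'"
  then show "(\<gamma> \<star>\<^bsub>Mnd B\<^esub> \<beta>) \<star>\<^bsub>Mnd B\<^esub> \<alpha> = \<gamma> \<star>\<^bsub>Mnd B\<^esub> \<beta> \<star>\<^bsub>Mnd B\<^esub> \<alpha>"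
    using HComp_assoc[of "fst W" "fst X" "fst Y" "fst Z" "fst f" "fst f'" "fst g" "fst g'"
        "fst h" "fst h'" \<alpha> \<beta> \<gamma>]
    by (simp add: fst_Mnd)
next
  fix X Y Z f g
  assume "X \<in> Obj (Mnd B)" "Y \<in> Obj (Mnd B)" "Z \<in> Obj (Mnd B)" "f \<in> Hom (Mnd B) X Y" "g \<in> Hom (Mnd B) Y Z"
  then show "Id2 (Mnd B) g \<star>\<^bsub>Mnd B\<^esub> Id2 (Mnd B) f = Id2 (Mnd B) (g \<cdot>\<^bsub>Mnd B\<^esub> f)"
    using HComp_Id2[of "fst X" "fst Y" "fst Z" "fst f" "fst g"] by (simp add: fst_Mnd)
next
  fix X Y Z f f' f'' g g' g'' \<alpha> \<alpha>' \<beta> \<beta>'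
  assume "X \<in> Obj (Mnd B)" "Y \<in> Obj (Mnd B)" "Z \<in> Obj (Mnd B)"
    "f \<in> Hom (Mnd B) X Y" "f' \<in> Hom (Mnd B) X Y" "f'' \<in> Hom (Mnd B) X Y"
    "g \<in> Hom (Mnd B) Y Z" "g' \<in> Hom (Mnd B) Y Z" "g'' \<in> Hom (Mnd B) Y Z"
    "\<alpha> \<in> Cell (Mnd B) X Y f f'" "\<alpha>' \<in> Cell (Mnd B) X Y f' f''"
    "\<beta> \<in> Cell (Mnd B) Y Z g g'" "\<beta>' \<in> Cell (Mnd B) Y Z g' g''"
  then show "(\<beta>' \<bullet>\<^bsub>Mnd B\<^esub> \<beta>) \<star>\<^bsub>Mnd B\<^esub> (\<alpha>' \<bullet>\<^bsub>Mnd B\<^esub> \<alpha>) = (\<beta>' \<star>\<^bsub>Mnd B\<^esub> \<alpha>') \<bullet>\<^bsub>Mnd B\<^esub> (\<beta> \<star>\<^bsub>Mnd B\<^esub> \<alpha>)"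
    using interchange[of "fst X" "fst Y" "fst Z" "fst f" "fst f'" "fst f''" "fst g" "fst g'" "fst g''"
        \<alpha> \<alpha>' \<beta> \<beta>']
    by (simp add: fst_Mnd)
qed

end

section \<open>Isomorphisms that are the identity on 2-cells\<close>

text \<open>
  The 2-cells and their composition operations are literally the same on both sides, so equations
  between 2-cells are transported without reference to their boundaries. Neither side is assumed to
  be a 2-category: that the source is one is deduced from the target in \<open>two_category_domain\<close>.
\<close>

locale relabelling =
  fixes A :: "('o, 'a, 'c) two_cat" and B :: "('p, 'b, 'c) two_cat"
    and F0 :: "'o \<Rightarrow> 'p" and F1 :: "'a \<Rightarrow> 'b"
  assumes bij_Obj: "bij_betw F0 (Obj A) (Obj B)"
    and bij_Hom: "\<lbrakk>X \<in> Obj A; Y \<in> Obj A\<rbrakk> \<Longrightarrow> bij_betw F1 (Hom A X Y) (Hom B (F0 X) (F0 Y))"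
    and map_Cell: "\<lbrakk>X \<in> Obj A; Y \<in> Obj A; f \<in> Hom A X Y; g \<in> Hom A X Y\<rbrakk>
      \<Longrightarrow> Cell B (F0 X) (F0 Y) (F1 f) (F1 g) = Cell A X Y f g"
    and map_Id1: "X \<in> Obj A \<Longrightarrow> F1 (Id1 A X) = Id1 B (F0 X)"
    and map_Comp: "\<lbrakk>X \<in> Obj A; Y \<in> Obj A; Z \<in> Obj A; f \<in> Hom A X Y; g \<in> Hom A Y Z\<rbrakk>
      \<Longrightarrow> F1 (g \<cdot>\<^bsub>A\<^esub> f) = F1 g \<cdot>\<^bsub>B\<^esub> F1 f"
    and map_Id2: "\<lbrakk>X \<in> Obj A; Y \<in> Obj A; f \<in> Hom A X Y\<rbrakk> \<Longrightarrow> Id2 B (F1 f) = Id2 A f"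
    and map_VComp: "VComp B = VComp A"
    and map_HComp: "HComp B = HComp A"
begin

lemma F0_Obj: "X \<in> Obj A \<Longrightarrow> F0 X \<in> Obj B"
  using bij_Obj by (rule bij_betwE[rule_format])

lemma F1_Hom: "\<lbrakk>X \<in> Obj A; Y \<in> Obj A; f \<in> Hom A X Y\<rbrakk> \<Longrightarrow> F1 f \<in> Hom B (F0 X) (F0 Y)"
  using bij_Hom bij_betwE by blast

lemma F1_inj: "\<lbrakk>X \<in> Obj A; Y \<in> Obj A; f \<in> Hom A X Y; g \<in> Hom A X Y; F1 f = F1 g\<rbrakk> \<Longrightarrow> f = g"
  using bij_Hom bij_betw_inv_into_left by metis

lemma whiskers:
  assumes "X \<in> Obj A" "Y \<in> Obj A" "f \<in> Hom A X Y"
  shows "whisker_left B (F1 f) \<alpha> = whisker_left A f \<alpha>"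
    "whisker_right B \<alpha> (F1 f) = whisker_right A \<alpha> f"
  using assms by (simp_all add: whisker_left_def whisker_right_def map_Id2 map_HComp)

text \<open>Equations between 1-cells are pulled back by injectivity of \<open>F1\<close>, which
  holds only within one hom-set. Closure of \<open>A\<close> under identities and composition is
  therefore a premise: a composite outside its hom-set could still be sent into the right hom-set of
  \<open>B\<close>.\<close>

lemma two_category_domain:
  assumes B: "two_category B"
    and Id1: "\<And>X. X \<in> Obj A \<Longrightarrow> Id1 A X \<in> Hom A X X"
    and Comp: "\<And>X Y Z f g. \<lbrakk>X \<in> Obj A; Y \<in> Obj A; Z \<in> Obj A; f \<in> Hom A X Y; g \<in> Hom A Y Z\<rbrakk>
      \<Longrightarrow> g \<cdot>\<^bsub>A\<^esub> f \<in> Hom A X Z"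
  shows "two_category A"
proof -
  interpret B: two_category B by fact
  note F = F0_Obj F1_Hom
  show ?thesis
  proof
    fix X assume "X \<in> Obj A" then show "Id1 A X \<in> Hom A X X" by (rule Id1)
  next
    fix X Y Z f g
    assume a: "X \<in> Obj A" "Y \<in> Obj A" "Z \<in> Obj A" "f \<in> Hom A X Y" "g \<in> Hom A Y Z"
    then show "g \<cdot>\<^bsub>A\<^esub> f \<in> Hom A X Z" by (rule Comp)
    show "Id2 A g \<star>\<^bsub>A\<^esub> Id2 A f = Id2 A (g \<cdot>\<^bsub>A\<^esub> f)"
      using a B.HComp_Id2[of "F0 X" "F0 Y" "F0 Z" "F1 f" "F1 g"] map_Id2[OF a(1,3) Comp[OF a]]
      by (simp add: F map_Comp[OF a] map_HComp map_Id2[OF a(1,2,4)] map_Id2[OF a(2,3,5)])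
  next
    fix W X Y Z f g h
    assume a: "W \<in> Obj A" "X \<in> Obj A" "Y \<in> Obj A" "Z \<in> Obj A"
      "f \<in> Hom A W X" "g \<in> Hom A X Y" "h \<in> Hom A Y Z"
    note gf = Comp[OF a(1-3,5,6)] and hg = Comp[OF a(2-4,6,7)]
    show "(h \<cdot>\<^bsub>A\<^esub> g) \<cdot>\<^bsub>A\<^esub> f = h \<cdot>\<^bsub>A\<^esub> (g \<cdot>\<^bsub>A\<^esub> f)"
    proof (rule F1_inj[OF a(1,4)])
      show "F1 ((h \<cdot>\<^bsub>A\<^esub> g) \<cdot>\<^bsub>A\<^esub> f) = F1 (h \<cdot>\<^bsub>A\<^esub> (g \<cdot>\<^bsub>A\<^esub> f))"
        using a B.Comp_assoc[of "F0 W" "F0 X" "F0 Y" "F0 Z" "F1 f" "F1 g" "F1 h"]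
        by (simp add: F map_Comp[OF a(1,2,4,5) hg] map_Comp[OF a(1,3,4) gf a(7)]
            map_Comp[OF a(2-4,6,7)] map_Comp[OF a(1-3,5,6)])
    qed (use Comp[OF a(1,2,4,5) hg] Comp[OF a(1,3,4) gf a(7)] in auto)
  next
    fix X Y f
    assume a: "X \<in> Obj A" "Y \<in> Obj A" "f \<in> Hom A X Y"
    note x = Id1[OF a(1)] and y = Id1[OF a(2)]
    show "Id1 A Y \<cdot>\<^bsub>A\<^esub> f = f"
    proof (rule F1_inj[OF a(1,2)])
      show "F1 (Id1 A Y \<cdot>\<^bsub>A\<^esub> f) = F1 f"
        using a B.Comp_Id1_left[of "F0 X" "F0 Y" "F1 f"]
        by (simp add: F map_Comp[OF a(1,2,2,3) y] map_Id1)
    qed (use Comp[OF a(1,2,2,3) y] a in auto)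
    show "f \<cdot>\<^bsub>A\<^esub> Id1 A X = f"
    proof (rule F1_inj[OF a(1,2)])
      show "F1 (f \<cdot>\<^bsub>A\<^esub> Id1 A X) = F1 f"
        using a B.Comp_Id1_right[of "F0 X" "F0 Y" "F1 f"]
        by (simp add: F map_Comp[OF a(1,1,2) x a(3)] map_Id1)
    qed (use Comp[OF a(1,1,2) x a(3)] a in auto)
    show "Id2 A f \<in> Cell A X Y f f"
      using a B.Id2_in_Cell[of "F0 X" "F0 Y" "F1 f"] by (simp add: F map_Cell map_Id2[OF a])
  next
    fix X Y f g h \<alpha> \<beta>
    assume "X \<in> Obj A" "Y \<in> Obj A" "f \<in> Hom A X Y" "g \<in> Hom A X Y" "h \<in> Hom A X Y"
      "\<alpha> \<in> Cell A X Y f g" "\<beta> \<in> Cell A X Y g h"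
    then show "\<beta> \<bullet>\<^bsub>A\<^esub> \<alpha> \<in> Cell A X Y f h"
      using B.VComp_in_Cell[of "F0 X" "F0 Y" "F1 f" "F1 g" "F1 h" \<alpha> \<beta>]
      by (simp add: F map_Cell map_VComp)
  next
    fix X Y f g h k \<alpha> \<beta> \<gamma>
    assume "X \<in> Obj A" "Y \<in> Obj A" "f \<in> Hom A X Y" "g \<in> Hom A X Y" "h \<in> Hom A X Y" "k \<in> Hom A X Y"
      "\<alpha> \<in> Cell A X Y f g" "\<beta> \<in> Cell A X Y g h" "\<gamma> \<in> Cell A X Y h k"
    then show "(\<gamma> \<bullet>\<^bsub>A\<^esub> \<beta>) \<bullet>\<^bsub>A\<^esub> \<alpha> = \<gamma> \<bullet>\<^bsub>A\<^esub> (\<beta> \<bullet>\<^bsub>A\<^esub> \<alpha>)"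
      using B.VComp_assoc[of "F0 X" "F0 Y" "F1 f" "F1 g" "F1 h" "F1 k" \<alpha> \<beta> \<gamma>]
      by (simp add: F map_Cell map_VComp)
  next
    fix X Y f g \<alpha>
    assume a: "X \<in> Obj A" "Y \<in> Obj A" "f \<in> Hom A X Y" "g \<in> Hom A X Y" "\<alpha> \<in> Cell A X Y f g"
    note Id2s = map_Id2[OF a(1-3)] map_Id2[OF a(1,2,4)] map_Id2[OF a(1,1) Id1[OF a(1)]]
      map_Id2[OF a(2,2) Id1[OF a(2)]]
    show "Id2 A g \<bullet>\<^bsub>A\<^esub> \<alpha> = \<alpha>" "\<alpha> \<bullet>\<^bsub>A\<^esub> Id2 A f = \<alpha>"
      "Id2 A (Id1 A Y) \<star>\<^bsub>A\<^esub> \<alpha> = \<alpha>" "\<alpha> \<star>\<^bsub>A\<^esub> Id2 A (Id1 A X) = \<alpha>"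
      using a Id2s B.VComp_Id2_left[of "F0 X" "F0 Y" "F1 f" "F1 g" \<alpha>]
        B.VComp_Id2_right[of "F0 X" "F0 Y" "F1 f" "F1 g" \<alpha>]
        B.HComp_Id_left[of "F0 X" "F0 Y" "F1 f" "F1 g" \<alpha>]
        B.HComp_Id_right[of "F0 X" "F0 Y" "F1 f" "F1 g" \<alpha>]
      by (simp_all add: F map_Cell map_VComp map_HComp map_Id1)
  next
    fix X Y Z f f' g g' \<alpha> \<beta>
    assume a: "X \<in> Obj A" "Y \<in> Obj A" "Z \<in> Obj A"
      "f \<in> Hom A X Y" "f' \<in> Hom A X Y" "g \<in> Hom A Y Z" "g' \<in> Hom A Y Z"
      "\<alpha> \<in> Cell A X Y f f'" "\<beta> \<in> Cell A Y Z g g'"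
    then show "\<beta> \<star>\<^bsub>A\<^esub> \<alpha> \<in> Cell A X Z (g \<cdot>\<^bsub>A\<^esub> f) (g' \<cdot>\<^bsub>A\<^esub> f')"
      using B.HComp_in_Cell[of "F0 X" "F0 Y" "F0 Z" "F1 f" "F1 f'" "F1 g" "F1 g'" \<alpha> \<beta>]
        map_Cell[OF a(1,3) Comp[OF a(1-3,4,6)] Comp[OF a(1-3,5,7)]]
      by (simp add: F map_Cell map_HComp map_Comp[OF a(1-3,4,6)] map_Comp[OF a(1-3,5,7)])
  next
    fix W X Y Z f f' g g' h h' \<alpha> \<beta> \<gamma>
    assume "W \<in> Obj A" "X \<in> Obj A" "Y \<in> Obj A" "Z \<in> Obj A"
      "f \<in> Hom A W X" "f' \<in> Hom A W X" "g \<in> Hom A X Y" "g' \<in> Hom A X Y"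
      "h \<in> Hom A Y Z" "h' \<in> Hom A Y Z"
      "\<alpha> \<in> Cell A W X f f'" "\<beta> \<in> Cell A X Y g g'" "\<gamma> \<in> Cell A Y Z h h'"
    then show "(\<gamma> \<star>\<^bsub>A\<^esub> \<beta>) \<star>\<^bsub>A\<^esub> \<alpha> = \<gamma> \<star>\<^bsub>A\<^esub> (\<beta> \<star>\<^bsub>A\<^esub> \<alpha>)"
      using B.HComp_assoc[of "F0 W" "F0 X" "F0 Y" "F0 Z" "F1 f" "F1 f'" "F1 g" "F1 g'"
          "F1 h" "F1 h'" \<alpha> \<beta> \<gamma>]
      by (simp add: F map_Cell map_HComp)
  next
    fix X Y Z f f' f'' g g' g'' \<alpha> \<alpha>' \<beta> \<beta>'
    assume "X \<in> Obj A" "Y \<in> Obj A" "Z \<in> Obj A"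
      "f \<in> Hom A X Y" "f' \<in> Hom A X Y" "f'' \<in> Hom A X Y"
      "g \<in> Hom A Y Z" "g' \<in> Hom A Y Z" "g'' \<in> Hom A Y Z"
      "\<alpha> \<in> Cell A X Y f f'" "\<alpha>' \<in> Cell A X Y f' f''"
      "\<beta> \<in> Cell A Y Z g g'" "\<beta>' \<in> Cell A Y Z g' g''"
    then show "(\<beta>' \<bullet>\<^bsub>A\<^esub> \<beta>) \<star>\<^bsub>A\<^esub> (\<alpha>' \<bullet>\<^bsub>A\<^esub> \<alpha>) = (\<beta>' \<star>\<^bsub>A\<^esub> \<alpha>') \<bullet>\<^bsub>A\<^esub> (\<beta> \<star>\<^bsub>A\<^esub> \<alpha>)"
      using B.interchange[of "F0 X" "F0 Y" "F0 Z" "F1 f" "F1 f'" "F1 f''" "F1 g" "F1 g'" "F1 g''"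
          \<alpha> \<alpha>' \<beta> \<beta>']
      by (simp add: F map_Cell map_HComp map_VComp)
  qed
qed

lemma two_category_iso:
  assumes "two_category A" "two_category B"
  shows "two_category_iso A B F0 F1 (\<lambda>\<alpha>. \<alpha>)"
proof -
  interpret A: two_category A by fact
  interpret B: two_category B by fact
  show ?thesis
    by unfold_locales
      (simp_all add: bij_Obj bij_Hom map_Cell map_Id1 map_Comp map_Id2 map_VComp map_HComp
        bij_betw_id[unfolded id_def])
qed

text \<open>Unit, multiplication and the operations on 2-cells are the same on both sides, so the
  monad laws are the same equations and only boundaries are translated. That \<open>End S\<close> is
  a 1-cell of \<open>A\<close> is a premise because \<open>F1\<close> may send something outside
  \<open>Hom A X X\<close> into the hom-set of \<open>B\<close>.\<close>

lemma monad_map: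
  assumes "two_category A" and X: "X \<in> Obj A" and S: "End S \<in> Hom A X X"
  shows "is_monad B (F0 X) (map_monad F1 id S) \<longleftrightarrow> is_monad A X S"
proof -
  interpret A: two_category A by fact
  note SS = A.Comp_in_Hom[OF X X X S S] and I = A.Id1_in_Hom[OF X]
  show ?thesis
    by (simp add: is_monad_def monad.map_sel S F1_Hom[OF X X S] map_VComp whiskers[OF X X S]
        map_Cell[OF X X I S, unfolded map_Id1[OF X]]
        map_Cell[OF X X SS S, unfolded map_Comp[OF X X X S S]] map_Id2[OF X X S])
qed

lemma monad_morphism_map:
  assumes "two_category A" and X: "X \<in> Obj A" and S: "End S \<in> Hom A X X"
    and X': "X' \<in> Obj A" and S': "End S' \<in> Hom A X' X'" and T: "T \<in> Hom A X X'"
  shows "is_monad_morphism B (F0 X, map_monad F1 id S) (F0 X', map_monad F1 id S') (F1 T, \<tau>)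
    \<longleftrightarrow> is_monad_morphism A (X, S) (X', S') (T, \<tau>)"
proof -
  interpret A: two_category A by fact
  note TS = A.Comp_in_Hom[OF X X X' S T] and S'T = A.Comp_in_Hom[OF X X' X' T S']
  show ?thesis
    by (simp add: is_monad_morphism_def monad.map_sel T F1_Hom[OF X X' T] map_VComp
        whiskers[OF X X S] whiskers[OF X' X' S'] whiskers[OF X X' T]
        map_Cell[OF X X' S'T TS, unfolded map_Comp[OF X X X' S T] map_Comp[OF X X' X' T S']])
qed

lemma monad_2cell_map:
  assumes X: "X \<in> Obj A" and S: "End S \<in> Hom A X X"
    and X': "X' \<in> Obj A" and S': "End S' \<in> Hom A X' X'"
    and T: "T \<in> Hom A X X'" and U: "U \<in> Hom A X X'"
  shows "is_monad_2cell B (F0 X, map_monad F1 id S) (F0 X', map_monad F1 id S') (F1 T, \<tau>) (F1 U, \<sigma>) \<alpha>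
    \<longleftrightarrow> is_monad_2cell A (X, S) (X', S') (T, \<tau>) (U, \<sigma>) \<alpha>"
  by (simp add: is_monad_2cell_def monad.map_sel map_VComp map_Cell[OF X X' T U]
      whiskers[OF X X S] whiskers[OF X' X' S'])

text \<open>To lift a monad or a morphism from \<open>Mnd B\<close>, it is enough to lift the
  underlying 1-cell through \<open>bij_Hom\<close>, the 2-cells being kept. In the induction this
  applies \<open>Mnd\<close> to the isomorphism already obtained for \<open>n\<close>.\<close>

lemma relabelling_Mnd:
  assumes A: "two_category A"
  shows "relabelling (Mnd A) (Mnd B) (map_prod F0 (map_monad F1 id)) (map_prod F1 id)"
proof
  have End: "End S \<in> Hom A X X" if "is_monad A X S" for X S
    using that by (simp add: is_monad_def)
  show "bij_betw (map_prod F0 (map_monad F1 id)) (Obj (Mnd A)) (Obj (Mnd B))"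
  proof (rule bij_betw_imageI)
    show "inj_on (map_prod F0 (map_monad F1 id)) (Obj (Mnd A))"
    proof (rule inj_onI, clarsimp simp: Mnd_def)
      fix X S Y S'
      assume X: "X \<in> Obj A" "is_monad A X S" "Y \<in> Obj A" "is_monad A Y S'" "F0 X = F0 Y"
        and eq: "map_monad F1 id S = map_monad F1 id S'"
      \<comment> \<open>The 0-cells come first: \<open>F1\<close> is injective on a single hom-set
        only, so \<open>S\<close> and \<open>S'\<close> can be compared once they are monads on the
        same 0-cell.\<close>
      then have "X = Y"
        using bij_Obj by (auto simp: bij_betw_def dest: inj_onD)
      with X eq show "X = Y \<and> S = S'"
        by (cases S; cases S') (auto dest!: End intro: F1_inj)
    qed
    show "map_prod F0 (map_monad F1 id) ` Obj (Mnd A) = Obj (Mnd B)"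
    proof (intro equalityI subsetI)
      fix p assume "p \<in> map_prod F0 (map_monad F1 id) ` Obj (Mnd A)"
      then show "p \<in> Obj (Mnd B)"
        by (auto simp: Mnd_def F0_Obj monad_map[OF A _ End])
    next
      fix p assume "p \<in> Obj (Mnd B)"
      then obtain Y M where p: "p = (Y, M)" "Y \<in> Obj B" "is_monad B Y M"
        by (auto simp: Mnd_def)
      then obtain X where X: "X \<in> Obj A" "Y = F0 X"
        using bij_Obj by (auto simp: bij_betw_def)
      moreover have "End M \<in> Hom B Y Y"
        using p by (simp add: is_monad_def)
      ultimately obtain f where f: "f \<in> Hom A X X" "End M = F1 f"
        using bij_Hom[of X X] by (auto simp: bij_betw_def)
      \<comment> \<open>The preimage replaces only the underlying 1-cell by its lift
        \<open>f\<close>; unit and multiplication stay.\<close>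
      have M: "M = map_monad F1 id (Monad f (Unit M) (Mult M))"
        using f by (cases M) simp
      then have "is_monad A X (Monad f (Unit M) (Mult M))"
        using monad_map[OF A X(1), of "Monad f (Unit M) (Mult M)"] p X f by simp
      with M X p show "p \<in> map_prod F0 (map_monad F1 id) ` Obj (Mnd A)"
        by (intro image_eqI[of _ _ "(X, Monad f (Unit M) (Mult M))"]) (auto simp: Mnd_def)
    qed
  qed
next
  have End: "End S \<in> Hom A X X" if "is_monad A X S" for X S
    using that by (simp add: is_monad_def)
  fix x y assume "x \<in> Obj (Mnd A)" "y \<in> Obj (Mnd A)"
  then obtain X S X' S' where xy: "x = (X, S)" "y = (X', S')"
    and X: "X \<in> Obj A" "X' \<in> Obj A" and S: "End S \<in> Hom A X X" "End S' \<in> Hom A X' X'"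
    using End by (auto simp: Mnd_def)
  note mm = monad_morphism_map[OF A X(1) S(1) X(2) S(2)]
  show "bij_betw (map_prod F1 id) (Hom (Mnd A) x y)
    (Hom (Mnd B) (map_prod F0 (map_monad F1 id) x) (map_prod F0 (map_monad F1 id) y))"
  proof (rule bij_betw_imageI)
    show "inj_on (map_prod F1 id) (Hom (Mnd A) x y)"
      using F1_inj[OF X] by (auto simp: inj_on_def Mnd_def xy is_monad_morphism_def)
    show "map_prod F1 id ` Hom (Mnd A) x y
      = Hom (Mnd B) (map_prod F0 (map_monad F1 id) x) (map_prod F0 (map_monad F1 id) y)"
    proof (intro equalityI subsetI)
      fix p assume "p \<in> map_prod F1 id ` Hom (Mnd A) x y"
      then obtain T \<tau> where "p = (F1 T, \<tau>)" "is_monad_morphism A x y (T, \<tau>)"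
        by (auto simp: Mnd_def)
      moreover from this have "T \<in> Hom A X X'"
        by (auto simp: xy is_monad_morphism_def)
      ultimately show "p \<in> Hom (Mnd B) (map_prod F0 (map_monad F1 id) x) (map_prod F0 (map_monad F1 id) y)"
        by (simp add: Mnd_def xy mm)
    next
      fix p assume p: "p \<in> Hom (Mnd B) (map_prod F0 (map_monad F1 id) x) (map_prod F0 (map_monad F1 id) y)"
      obtain T' \<tau> where [simp]: "p = (T', \<tau>)" by (cases p)
      from p have "T' \<in> Hom B (F0 X) (F0 X')"
        by (auto simp: Mnd_def xy is_monad_morphism_def)
      then obtain T where T: "T \<in> Hom A X X'" "T' = F1 T"
        using bij_Hom[OF X] by (auto simp: bij_betw_def)
      with p have "is_monad_morphism A x y (T, \<tau>)"
        by (simp add: Mnd_def xy mm)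
      with T show "p \<in> map_prod F1 id ` Hom (Mnd A) x y"
        by (intro image_eqI[of _ _ "(T, \<tau>)"]) (auto simp: Mnd_def)
    qed
  qed
  fix f g assume "f \<in> Hom (Mnd A) x y" "g \<in> Hom (Mnd A) x y"
  then obtain T \<tau> U \<sigma> where fg: "f = (T, \<tau>)" "g = (U, \<sigma>)" "T \<in> Hom A X X'" "U \<in> Hom A X X'"
    by (cases f; cases g) (auto simp: Mnd_def xy is_monad_morphism_def)
  then show "Cell (Mnd B) (map_prod F0 (map_monad F1 id) x) (map_prod F0 (map_monad F1 id) y)
    (map_prod F1 id f) (map_prod F1 id g) = Cell (Mnd A) x y f g"
    using monad_2cell_map[OF X(1) S(1) X(2) S(2)] by (auto simp: Mnd_def xy)
next
  fix x assume "x \<in> Obj (Mnd A)"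
  then show "map_prod F1 id (Id1 (Mnd A) x) = Id1 (Mnd B) (map_prod F0 (map_monad F1 id) x)"
    by (auto simp: Mnd_def map_Id1 map_Id2 is_monad_def monad.map_sel)
next
  fix x y z f g
  assume "x \<in> Obj (Mnd A)" "y \<in> Obj (Mnd A)" "z \<in> Obj (Mnd A)" "f \<in> Hom (Mnd A) x y" "g \<in> Hom (Mnd A) y z"
  then show "map_prod F1 id (g \<cdot>\<^bsub>Mnd A\<^esub> f) = map_prod F1 id g \<cdot>\<^bsub>Mnd B\<^esub> map_prod F1 id f"
    by (cases f; cases g) (auto simp: Mnd_def is_monad_morphism_def map_Comp map_VComp whiskers)
next
  fix x y f
  assume "x \<in> Obj (Mnd A)" "y \<in> Obj (Mnd A)" "f \<in> Hom (Mnd A) x y"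
  then show "Id2 (Mnd B) (map_prod F1 id f) = Id2 (Mnd A) f"
    by (cases f) (auto simp: Mnd_def is_monad_morphism_def map_Id2)
qed (simp_all add: map_VComp map_HComp)

end

section \<open>Composites of relabellings, and renaming as a relabelling\<close>

lemma relabelling_trans:
  assumes "relabelling A B F0 F1" "relabelling B C G0 G1"
  shows "relabelling A C (G0 \<circ> F0) (G1 \<circ> F1)"
proof -
  interpret F: relabelling A B F0 F1 by fact
  interpret G: relabelling B C G0 G1 by fact
  note F = F.F0_Obj F.F1_Hom
  show ?thesis
  proof
    show "bij_betw (G0 \<circ> F0) (Obj A) (Obj C)"
      using F.bij_Obj G.bij_Obj by (rule bij_betw_trans)
  next
    fix X Y assume "X \<in> Obj A" "Y \<in> Obj A"
    then show "bij_betw (G1 \<circ> F1) (Hom A X Y) (Hom C ((G0 \<circ> F0) X) ((G0 \<circ> F0) Y))"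
      using bij_betw_trans[OF F.bij_Hom G.bij_Hom] by (simp add: F)
  next
    fix X Y f g assume "X \<in> Obj A" "Y \<in> Obj A" "f \<in> Hom A X Y" "g \<in> Hom A X Y"
    then show "Cell C ((G0 \<circ> F0) X) ((G0 \<circ> F0) Y) ((G1 \<circ> F1) f) ((G1 \<circ> F1) g) = Cell A X Y f g"
      by (simp add: F F.map_Cell G.map_Cell)
  next
    fix X assume "X \<in> Obj A"
    then show "(G1 \<circ> F1) (Id1 A X) = Id1 C ((G0 \<circ> F0) X)"
      by (simp add: F F.map_Id1 G.map_Id1)
  next
    fix X Y Z f g
    assume a: "X \<in> Obj A" "Y \<in> Obj A" "Z \<in> Obj A" "f \<in> Hom A X Y" "g \<in> Hom A Y Z"
    then show "(G1 \<circ> F1) (g \<cdot>\<^bsub>A\<^esub> f) = (G1 \<circ> F1) g \<cdot>\<^bsub>C\<^esub> (G1 \<circ> F1) f"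
      using G.map_Comp[of "F0 X" "F0 Y" "F0 Z" "F1 f" "F1 g"] by (simp add: F F.map_Comp[OF a])
  next
    fix X Y f assume a: "X \<in> Obj A" "Y \<in> Obj A" "f \<in> Hom A X Y"
    then show "Id2 C ((G1 \<circ> F1) f) = Id2 A f"
      using G.map_Id2[of "F0 X" "F0 Y" "F1 f"] by (simp add: F F.map_Id2[OF a])
  qed (simp_all add: F.map_VComp F.map_HComp G.map_VComp G.map_HComp)
qed

text \<open>Injectivity makes \<open>inv\<close> a left inverse, so renaming works in both
  directions. The forward one leads into \<open>Mnd_pow\<close>; the backward one has
  \<open>C\<close> as target, so that \<open>two_category_domain\<close> transfers the axioms to the
  copy.\<close>

lemma relabelling_rename_cells:
  assumes "inj \<phi>" "inj \<psi>"
  shows "relabelling C (rename_cells \<phi> \<psi> C) \<phi> \<psi>"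
    and "relabelling (rename_cells \<phi> \<psi> C) C (inv \<phi>) (inv \<psi>)"
  using assms
  by unfold_locales
    (auto simp: rename_cells_def bij_betw_def inj_on_def image_image)

lemma two_category_rename_cells:
  assumes "two_category C" "inj \<phi>" "inj \<psi>"
  shows "two_category (rename_cells \<phi> \<psi> C)"
proof -
  interpret C: two_category C by fact
  interpret relabelling "rename_cells \<phi> \<psi> C" C "inv \<phi>" "inv \<psi>"
    by (rule relabelling_rename_cells) fact+
  show ?thesis
    by (rule two_category_domain[OF assms(1)])
      (use assms(2,3) in \<open>auto simp: rename_cells_def intro!: imageI intro: C.Id1_in_Hom C.Comp_in_Hom\<close>)
qed

section \<open>Splitting off the last monad\<close>

text \<open>Whiskering by a tuple sees only its underlying 1-cell. Monad conditions over
  \<open>Mnd_tuples n B\<close> thereby turn into equations of \<open>B\<close>.\<close>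

lemma whisker_Mnd_tuples [simp]:
  "whisker_left (Mnd_tuples n B) (T, \<tau>) \<alpha> = whisker_left B T \<alpha>"
  "whisker_right (Mnd_tuples n B) \<alpha> (T, \<tau>) = whisker_right B \<alpha> T"
  by (simp_all add: whisker_left_def whisker_right_def Mnd_tuples_def)

text \<open>Here and in the next three lemmas, the conditions on \<open>Suc n\<close> indices are
  divided into those on indices up to \<open>n\<close> and those whose largest index is
  \<open>Suc n\<close>.\<close>

lemma index_pairs_Suc: "index_pairs (Suc n) = index_pairs n \<union> (\<lambda>i. (i, Suc n)) ` {1..n}"
  by (auto simp: index_pairs_def)

lemma Ball_Suc: "(\<forall>i\<in>{1..Suc n}. P i) \<longleftrightarrow> (\<forall>i\<in>{1..n}. P i) \<and> P (Suc n)"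
  by (simp add: atLeastAtMostSuc_conv conj_commute)

lemma Ball_index_pairs_Suc:
  "(\<forall>(i, j)\<in>index_pairs (Suc n). P i j)
    \<longleftrightarrow> (\<forall>(i, j)\<in>index_pairs n. P i j) \<and> (\<forall>i\<in>{1..n}. P i (Suc n))"
  by (auto simp: index_pairs_Suc)

lemma all_triples_Suc:
  "(\<forall>i j k. 1 \<le> i \<and> i < j \<and> j < k \<and> k \<le> Suc n \<longrightarrow> P i j k)
    \<longleftrightarrow> (\<forall>i j k. 1 \<le> i \<and> i < j \<and> j < k \<and> k \<le> n \<longrightarrow> P i j k) \<and>
        (\<forall>(i, j)\<in>index_pairs n. P i j (Suc n))"
  by (auto simp: index_pairs_def le_Suc_eq)

text \<open>One level of re-bracketing, with the entries up to \<open>n\<close> still forming a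
  tuple. The restrictions make the families extensional on the smaller index sets, as the cells of
  \<open>Mnd_tuples n B\<close> require.\<close>

definition split0 :: "nat \<Rightarrow> ('o, 'a, 'c) tuple0 \<Rightarrow> ('o, 'a, 'c) tuple0 \<times> (('a, 'c) tuple1, 'c) monad" where
  "split0 n = (\<lambda>(X, S, l).
     ((X, restrict S {1..n}, restrict l (index_pairs n)),
      Monad (End (S (Suc n)), \<lambda>i\<in>{1..n}. l (i, Suc n)) (Unit (S (Suc n))) (Mult (S (Suc n)))))"

definition split1 :: "nat \<Rightarrow> ('a, 'c) tuple1 \<Rightarrow> ('a, 'c) tuple1 \<times> 'c" where
  "split1 n = (\<lambda>(T, \<tau>). ((T, restrict \<tau> {1..n}), \<tau> (Suc n)))"

context two_category
begin

text \<open>Being a 1-cell, a unit 2-cell and a multiplication 2-cell over \<open>n\<close>-tuples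
  accounts for exactly the conditions that involve index \<open>Suc n\<close>. Extensionality is
  listed separately since \<open>split0\<close> does not see values outside the index sets.\<close>

lemma tuple0_Suc_iff:
  "is_tuple0 (Suc n) B (X, S, l) \<longleftrightarrow>
    S \<in> extensional {1..Suc n} \<and> l \<in> extensional (index_pairs (Suc n)) \<and>
    split0 n (X, S, l) \<in> Obj (Mnd (Mnd_tuples n B))"
proof (cases "is_tuple0 n B (X, restrict S {1..n}, restrict l (index_pairs n))")
  \<comment> \<open>Both sides require the first \<open>n\<close> entries to form an
    \<open>n\<close>-tuple, so here both fail.\<close>
  case False
  moreover have "is_tuple0 n B (X, restrict S {1..n}, restrict l (index_pairs n))"
    if "is_tuple0 (Suc n) B (X, S, l)"
    using that by (auto simp: is_tuple0_def index_pairs_def)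
  ultimately show ?thesis
    by (auto simp: split0_def Mnd_def Mnd_tuples_def)
next
  case True
  let ?T = "S (Suc n)" and ?l = "\<lambda>i. l (i, Suc n)"
  have X: "X \<in> Obj B" and S: "\<And>i. i \<in> {1..n} \<Longrightarrow> is_monad B X (S i)"
    using True by (auto simp: is_tuple0_def)
  \<comment> \<open>For an endo-1-cell the primed and unprimed data coincide; with \<open>?l\<close>
    as components, the compatibility condition for \<open>i < j\<close> is literally the Yang-Baxter
    equation for \<open>i\<close>, \<open>j\<close>, \<open>Suc n\<close>.\<close>
  have hom: "is_tuple1 n B (X, restrict S {1..n}, restrict l (index_pairs n))
      (X, restrict S {1..n}, restrict l (index_pairs n)) (End ?T, restrict ?l {1..n}) \<longleftrightarrow>
    End ?T \<in> Hom B X X \<and>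
    (\<forall>i\<in>{1..n}. ?l i \<in> Cell B X X (End (S i) \<cdot> End ?T) (End ?T \<cdot> End (S i)) \<and>
      ?l i \<bullet> (Unit (S i) \<rhd> End ?T) = End ?T \<lhd> Unit (S i) \<and>
      ?l i \<bullet> (Mult (S i) \<rhd> End ?T) =
        (End ?T \<lhd> Mult (S i)) \<bullet> (?l i \<rhd> End (S i)) \<bullet> (End (S i) \<lhd> ?l i)) \<and>
    (\<forall>(i, j)\<in>index_pairs n. yang_baxter B (End (S i)) (End (S j)) (End ?T) (l (i, j)) (?l i) (?l j))"
    by (auto simp: is_tuple1_def yang_baxter_def index_pairs_def)
  \<comment> \<open>The source is the identity 1-cell, whose components are identity 2-cells. They
    cancel once the unit is typed, leaving the unit law of the distributive law in its second
    monad.\<close>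
  have unit: "is_tuple2 n B (X, restrict S {1..n}, restrict l (index_pairs n))
      (X, restrict S {1..n}, restrict l (index_pairs n)) (Id1 B X, \<lambda>i\<in>{1..n}. Id2 B (End (restrict S {1..n} i)))
      (End ?T, restrict ?l {1..n}) (Unit ?T) \<longleftrightarrow>
    Unit ?T \<in> Cell B X X (Id1 B X) (End ?T) \<and>
    (\<forall>i\<in>{1..n}. ?l i \<bullet> (End (S i) \<lhd> Unit ?T) = Unit ?T \<rhd> End (S i))"
    if T: "End ?T \<in> Hom B X X"
  proof -
    have "(Unit ?T \<rhd> End (S i)) \<bullet> Id2 B (End (S i)) = Unit ?T \<rhd> End (S i)"
      if "i \<in> {1..n}" "Unit ?T \<in> Cell B X X (Id1 B X) (End ?T)" for i
    proof -
      have s: "arr (End (S i)) X X" and e: "cell (Unit ?T) X X (Id1 B X) (End ?T)"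
        using X S[OF that(1)] T that(2) by (auto simp: is_monad_def arr_def cell_def Id1_in_Hom)
      show ?thesis
        using cell_Id2_right[OF cell_right[OF s e]] by (simp add: arr_Id1_left[OF s])
    qed
    then show ?thesis
      by (auto simp: is_tuple2_def)
  qed
  \<comment> \<open>The source is the square of the endo-1-cell, whose components paste two copies
    of \<open>?l i\<close>; the condition is the multiplication law in the second monad.\<close>
  have mult: "is_tuple2 n B (X, restrict S {1..n}, restrict l (index_pairs n))
      (X, restrict S {1..n}, restrict l (index_pairs n))
      (End ?T \<cdot> End ?T, \<lambda>i\<in>{1..n}. (End ?T \<lhd> restrict ?l {1..n} i) \<bullet> (restrict ?l {1..n} i \<rhd> End ?T))
      (End ?T, restrict ?l {1..n}) (Mult ?T) \<longleftrightarrow>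
    Mult ?T \<in> Cell B X X (End ?T \<cdot> End ?T) (End ?T) \<and>
    (\<forall>i\<in>{1..n}. ?l i \<bullet> (End (S i) \<lhd> Mult ?T) =
      (Mult ?T \<rhd> End (S i)) \<bullet> (End ?T \<lhd> ?l i) \<bullet> (?l i \<rhd> End ?T))"
    by (auto simp: is_tuple2_def)
  have "split0 n (X, S, l) \<in> Obj (Mnd (Mnd_tuples n B)) \<longleftrightarrow>
    is_monad B X ?T \<and> (\<forall>i\<in>{1..n}. is_distributive_law B X (S i) ?T (?l i)) \<and>
    (\<forall>(i, j)\<in>index_pairs n. yang_baxter B (End (S i)) (End (S j)) (End ?T) (l (i, j)) (?l i) (?l j))"
    (is "?L \<longleftrightarrow> ?R")
  proof -
    have "?L \<longleftrightarrow> is_monad (Mnd_tuples n B) (X, restrict S {1..n}, restrict l (index_pairs n))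
      (Monad (End ?T, restrict ?l {1..n}) (Unit ?T) (Mult ?T))"
      using True by (simp add: split0_def Mnd_def Mnd_tuples_def)
    also have "\<dots> \<longleftrightarrow> ?R"
    \<comment> \<open>The cancellation in \<open>unit\<close> needs this typing; without it both
      sides are false.\<close>
    proof (cases "End ?T \<in> Hom B X X")
      case T: True
      show ?thesis
        using hom unit[OF T] mult T unfolding is_monad_def monad.sel whisker_Mnd_tuples
        by (simp add: Mnd_tuples_def is_distributive_law_def) blast
    next
      case False
      then show ?thesis
        using hom by (auto simp: is_monad_def Mnd_tuples_def)
    qed
    finally show ?thesis .
  qed
  moreover have "is_tuple0 (Suc n) B (X, S, l) \<longleftrightarrow>
    S \<in> extensional {1..Suc n} \<and> l \<in> extensional (index_pairs (Suc n)) \<and> ?R"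
  proof -
    have "(\<forall>(i, j)\<in>index_pairs n. is_distributive_law B X (S i) (S j) (l (i, j)))"
      using True by (auto simp: is_tuple0_def index_pairs_def)
    moreover have "\<forall>i j k. 1 \<le> i \<and> i < j \<and> j < k \<and> k \<le> n \<longrightarrow>
        yang_baxter B (End (S i)) (End (S j)) (End (S k)) (l (i, j)) (l (i, k)) (l (j, k))"
      using True by (auto simp: is_tuple0_def index_pairs_def)
    ultimately show ?thesis
      unfolding is_tuple0_def prod.case Ball_Suc Ball_index_pairs_Suc all_triples_Suc
      using X S by blast
  qed
  ultimately show ?thesis by simp
qed

text \<open>At index \<open>i\<close>, the 2-cell condition on \<open>\<tau> (Suc n)\<close> is the
  compatibility of \<open>\<tau> i\<close> with \<open>\<tau> (Suc n)\<close>; the two morphism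
  equations over tuples are those for index \<open>Suc n\<close>. The hypotheses on \<open>x\<close>
  and \<open>x'\<close> supply the boundaries needed to reassociate vertical composites.\<close>

lemma tuple1_Suc_iff:
  assumes x: "is_tuple0 (Suc n) B x" and x': "is_tuple0 (Suc n) B x'"
  shows "is_tuple1 (Suc n) B x x' (T, \<tau>) \<longleftrightarrow>
    \<tau> \<in> extensional {1..Suc n} \<and>
    split1 n (T, \<tau>) \<in> Hom (Mnd (Mnd_tuples n B)) (split0 n x) (split0 n x')"
proof -
  obtain X S l X' S' l' where xx: "x = (X, S, l)" "x' = (X', S', l')"
    by (metis surj_pair)
  let ?P = "\<lambda>i j. (\<tau> j \<rhd> End (S i)) \<bullet> (End (S' j) \<lhd> \<tau> i) \<bullet> (l' (i, j) \<rhd> T) =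
        (T \<lhd> l (i, j)) \<bullet> (\<tau> i \<rhd> End (S j)) \<bullet> (End (S' i) \<lhd> \<tau> j)"
  let ?Q = "\<lambda>i. \<tau> i \<in> Cell B X X' (End (S' i) \<cdot> T) (T \<cdot> End (S i)) \<and>
        \<tau> i \<bullet> (Unit (S' i) \<rhd> T) = T \<lhd> Unit (S i) \<and>
        \<tau> i \<bullet> (Mult (S' i) \<rhd> T) =
          (T \<lhd> Mult (S i)) \<bullet> (\<tau> i \<rhd> End (S i)) \<bullet> (End (S' i) \<lhd> \<tau> i)"
  let ?m = "Suc n"
  let ?R = "T \<in> Hom B X X' \<and> (\<forall>i\<in>{1..n}. ?Q i) \<and> ?Q ?m \<and>
    (\<forall>(i, j)\<in>index_pairs n. ?P i j) \<and> (\<forall>i\<in>{1..n}. ?P i ?m)"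
  have hom: "is_tuple1 n B (X, restrict S {1..n}, restrict l (index_pairs n))
      (X', restrict S' {1..n}, restrict l' (index_pairs n)) (T, restrict \<tau> {1..n}) \<longleftrightarrow>
    T \<in> Hom B X X' \<and> (\<forall>i\<in>{1..n}. ?Q i) \<and> (\<forall>(i, j)\<in>index_pairs n. ?P i j)"
    by (auto simp: is_tuple1_def index_pairs_def)
  \<comment> \<open>The two boundary 1-cells are composites, so their components are vertical
    composites. On the target side this brackets the equation differently from \<open>?P\<close>,
    and \<open>cell_assoc\<close> repairs it.\<close>
  have sq: "is_tuple2 n B (X, restrict S {1..n}, restrict l (index_pairs n))
      (X', restrict S' {1..n}, restrict l' (index_pairs n))
      (End (S' ?m) \<cdot> T, \<lambda>i\<in>{1..n}. (End (S' ?m) \<lhd> restrict \<tau> {1..n} i) \<bullet> ((\<lambda>i\<in>{1..n}. l' (i, ?m)) i \<rhd> T))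
      (T \<cdot> End (S ?m), \<lambda>i\<in>{1..n}. (T \<lhd> (\<lambda>i\<in>{1..n}. l (i, ?m)) i) \<bullet> (restrict \<tau> {1..n} i \<rhd> End (S ?m)))
      (\<tau> ?m) \<longleftrightarrow>
    \<tau> ?m \<in> Cell B X X' (End (S' ?m) \<cdot> T) (T \<cdot> End (S ?m)) \<and> (\<forall>i\<in>{1..n}. ?P i ?m)"
    if T: "T \<in> Hom B X X'" and Q: "\<forall>i\<in>{1..n}. ?Q i"
  proof -
    have "((T \<lhd> l (i, ?m)) \<bullet> (\<tau> i \<rhd> End (S ?m))) \<bullet> (End (S' i) \<lhd> \<tau> ?m)
      = (T \<lhd> l (i, ?m)) \<bullet> (\<tau> i \<rhd> End (S ?m)) \<bullet> (End (S' i) \<lhd> \<tau> ?m)"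
      if i: "i \<in> {1..n}" and "\<tau> ?m \<in> Cell B X X' (End (S' ?m) \<cdot> T) (T \<cdot> End (S ?m))" for i
    proof -
      have "(i, ?m) \<in> index_pairs (Suc n)"
        using i by (simp add: index_pairs_def)
      then have "is_distributive_law B X (S i) (S ?m) (l (i, ?m))"
        using x unfolding xx is_tuple0_def by blast
      then have l: "l (i, ?m) \<in> Cell B X X (End (S i) \<cdot> End (S ?m)) (End (S ?m) \<cdot> End (S i))"
        by (simp add: is_distributive_law_def)
      have X: "X \<in> Obj B" "X' \<in> Obj B" and "is_monad B X (S i)" "is_monad B X (S ?m)"
        "is_monad B X' (S' i)" "is_monad B X' (S' ?m)"
        using x x' i by (auto simp: xx is_tuple0_def)
      then have s: "arr (End (S i)) X X" "arr (End (S ?m)) X X" "arr (End (S' i)) X' X'"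
        "arr (End (S' ?m)) X' X'"
        by (auto intro: monad_cells)
      have t: "arr T X X'"
        using T X by (simp add: arr_def)
      have "cell (\<tau> ?m) X X' (End (S' ?m) \<cdot> T) (T \<cdot> End (S ?m))"
        using that(2) s t by (simp add: cell_def arr_Comp[of T X X'] arr_Comp[of _ X X _ X'])
      then have 1: "cell (End (S' i) \<lhd> \<tau> ?m) X X' (End (S' i) \<cdot> End (S' ?m) \<cdot> T) (End (S' i) \<cdot> T \<cdot> End (S ?m))"
        using s(3) by (rule cell_left)
      have "cell (\<tau> i) X X' (End (S' i) \<cdot> T) (T \<cdot> End (S i))"
        using Q i s t by (simp add: cell_def arr_Comp[of T X X'] arr_Comp[of _ X X _ X'])
      then have 2: "cell (\<tau> i \<rhd> End (S ?m)) X X' (End (S' i) \<cdot> T \<cdot> End (S ?m)) (T \<cdot> End (S i) \<cdot> End (S ?m))"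
        using cell_right[OF s(2)] arr_assoc[OF s(2) t s(3)] arr_assoc[OF s(2,1) t] by metis
      have "cell (l (i, ?m)) X X (End (S i) \<cdot> End (S ?m)) (End (S ?m) \<cdot> End (S i))"
        using l s by (simp add: cell_def arr_Comp)
      then have 3: "cell (T \<lhd> l (i, ?m)) X X' (T \<cdot> End (S i) \<cdot> End (S ?m)) (T \<cdot> End (S ?m) \<cdot> End (S i))"
        using t by (rule cell_left)
      show ?thesis
        by (rule cell_assoc[OF 1 2 3])
    qed
    then show ?thesis
      by (auto simp: is_tuple2_def)
  qed
  have "split1 n (T, \<tau>) \<in> Hom (Mnd (Mnd_tuples n B)) (split0 n x) (split0 n x') \<longleftrightarrow> ?R"
  \<comment> \<open>These conditions provide the typings for \<open>sq\<close>; if they fail, both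
    sides are false.\<close>
  proof (cases "T \<in> Hom B X X' \<and> (\<forall>i\<in>{1..n}. ?Q i)")
    case True
    then have T: "T \<in> Hom B X X'" and Q: "\<forall>i\<in>{1..n}. ?Q i"
      by auto
    show ?thesis
      using T Q hom sq[OF T Q]
      by (simp add: split0_def split1_def xx Mnd_def is_monad_morphism_def)
        (simp add: Mnd_tuples_def, blast)
  next
    case False
    then show ?thesis
      using hom by (auto simp: split0_def split1_def xx Mnd_def is_monad_morphism_def Mnd_tuples_def)
  qed
  moreover have "is_tuple1 (Suc n) B x x' (T, \<tau>) \<longleftrightarrow> \<tau> \<in> extensional {1..Suc n} \<and> ?R"
    unfolding xx is_tuple1_def prod.case Ball_Suc Ball_index_pairs_Suc by blast
  ultimately show ?thesis by simp
qed

end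

text \<open>An extensional family is determined by its part up to \<open>n\<close> and its entries
  with last index \<open>Suc n\<close>, and any such two pieces can be joined. The two equivalences
  above match the conditions.\<close>

lemma (in two_category) relabelling_split:
  "relabelling (Mnd_tuples (Suc n) B) (Mnd (Mnd_tuples n B)) (split0 n) (split1 n)"
proof
  let ?A = "Mnd_tuples (Suc n) B" and ?M = "Mnd (Mnd_tuples n B)"
  have Obj: "x \<in> Obj ?A \<longleftrightarrow> is_tuple0 (Suc n) B x" for x
    by (simp add: Mnd_tuples_def)
  have Hom: "f \<in> Hom ?A x y \<longleftrightarrow> is_tuple1 (Suc n) B x y f" for x y f
    by (simp add: Mnd_tuples_def)
  show "bij_betw (split0 n) (Obj ?A) (Obj ?M)"
  proof (rule bij_betw_imageI)
    show "inj_on (split0 n) (Obj ?A)"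
    proof (rule inj_onI)
      fix x y assume x: "x \<in> Obj ?A" and y: "y \<in> Obj ?A" and eq: "split0 n x = split0 n y"
      obtain X S l Y S' l' where xy: "x = (X, S, l)" "y = (Y, S', l')"
        by (metis surj_pair)
      have ext: "S \<in> extensional {1..Suc n}" "S' \<in> extensional {1..Suc n}"
        "l \<in> extensional (index_pairs (Suc n))" "l' \<in> extensional (index_pairs (Suc n))"
        using x y by (simp_all add: Obj xy is_tuple0_def)
      have r: "restrict S {1..n} = restrict S' {1..n}"
          "restrict l (index_pairs n) = restrict l' (index_pairs n)"
          "(\<lambda>i\<in>{1..n}. l (i, Suc n)) = (\<lambda>i\<in>{1..n}. l' (i, Suc n))"
          "X = Y" "S (Suc n) = S' (Suc n)"
        using eq by (auto simp: split0_def xy intro: monad.expand)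
      have "S i = S' i" if "i \<in> {1..Suc n}" for i
        using fun_cong[OF r(1), of i] r(5) that by (cases "i = Suc n") auto
      then have "S = S'"
        by (rule extensionalityI[OF ext(1,2)])
      moreover have "l p = l' p" if "p \<in> index_pairs (Suc n)" for p
        \<comment> \<open>A pair either has both indices at most \<open>n\<close>, settled by
          \<open>r(2)\<close>, or is \<open>(i, Suc n)\<close>, settled by
          \<open>r(3)\<close>.\<close>
        using that fun_cong[OF r(2), of p] fun_cong[OF r(3), of "fst p"]
        by (auto simp: index_pairs_Suc)
      then have "l = l'"
        by (rule extensionalityI[OF ext(3,4)])
      ultimately show "x = y"
        using r(4) by (simp add: xy)
    qed
    show "split0 n ` Obj ?A = Obj ?M"
    proof (intro equalityI subsetI)
      fix p assume "p \<in> split0 n ` Obj ?A"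
      then show "p \<in> Obj ?M"
        using tuple0_Suc_iff by (auto simp: Obj)
    next
      fix p assume p: "p \<in> Obj ?M"
      obtain X S l M where pM: "p = ((X, S, l), M)"
        by (metis surj_pair)
      obtain T \<tau> e m where M: "M = Monad (T, \<tau>) e m"
        by (metis monad.exhaust surj_pair)
      have ext: "S \<in> extensional {1..n}" "l \<in> extensional (index_pairs n)" "\<tau> \<in> extensional {1..n}"
        using p by (auto simp: pM M Mnd_def Mnd_tuples_def is_tuple0_def is_monad_def is_tuple1_def)
      \<comment> \<open>The inverse of \<open>split0\<close>: the last monad is placed at index
        \<open>Suc n\<close>, and the components of its endo-1-cell fill the entries
        \<open>(i, Suc n)\<close>.\<close>
      define S' where "S' = S(Suc n := Monad T e m)"
      define l' where "l' = (\<lambda>(i, j)\<in>index_pairs (Suc n). if j = Suc n then \<tau> i else l (i, j))"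
      have "restrict S' {1..n} = S"
        using ext(1) by (auto simp: S'_def fun_eq_iff extensional_def)
      moreover have "restrict l' (index_pairs n) = l"
        using ext(2) by (auto simp: l'_def fun_eq_iff extensional_def index_pairs_def)
      moreover have "(\<lambda>i\<in>{1..n}. l' (i, Suc n)) = \<tau>"
        using ext(3) by (auto simp: l'_def fun_eq_iff extensional_def index_pairs_def)
      ultimately have eq: "split0 n (X, S', l') = p"
        by (simp add: split0_def pM M S'_def)
      have "S' \<in> extensional {1..Suc n}" "l' \<in> extensional (index_pairs (Suc n))"
        using ext(1) by (auto simp: S'_def l'_def extensional_def)
      then have "(X, S', l') \<in> Obj ?A"
        using p eq by (simp add: Obj tuple0_Suc_iff)
      then show "p \<in> split0 n ` Obj ?A"
        using eq by blast
    qed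
  qed
  show "split1 n (Id1 ?A x) = Id1 ?M (split0 n x)" if "x \<in> Obj ?A" for x
    by (cases x) (auto simp: split0_def split1_def Mnd_def Mnd_tuples_def fun_eq_iff)
  show "split1 n (g \<cdot>\<^bsub>?A\<^esub> f) = split1 n g \<cdot>\<^bsub>?M\<^esub> split1 n f" for f g
    by (cases f; cases g) (auto simp: split1_def Mnd_def,
        auto simp: Mnd_tuples_def fun_eq_iff)
  show "Id2 ?M (split1 n f) = Id2 ?A f" for f
    by (cases f) (simp add: split1_def Mnd_def Mnd_tuples_def)
  show "VComp ?M = VComp ?A" "HComp ?M = HComp ?A"
    by (simp_all add: Mnd_def Mnd_tuples_def)
  fix x y assume x: "x \<in> Obj ?A" and y: "y \<in> Obj ?A"
  note iff = tuple1_Suc_iff[OF x[unfolded Obj] y[unfolded Obj]]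
  show "bij_betw (split1 n) (Hom ?A x y) (Hom ?M (split0 n x) (split0 n y))"
  proof (rule bij_betw_imageI)
    show "inj_on (split1 n) (Hom ?A x y)"
    proof (rule inj_onI)
      fix f g assume f: "f \<in> Hom ?A x y" and g: "g \<in> Hom ?A x y" and eq: "split1 n f = split1 n g"
      obtain T \<tau> U \<sigma> where fg: "f = (T, \<tau>)" "g = (U, \<sigma>)"
        by (metis surj_pair)
      have ext: "\<tau> \<in> extensional {1..Suc n}" "\<sigma> \<in> extensional {1..Suc n}"
        using f g by (simp_all add: Hom fg iff)
      have r: "restrict \<tau> {1..n} = restrict \<sigma> {1..n}" "T = U" "\<tau> (Suc n) = \<sigma> (Suc n)"
        using eq by (auto simp: split1_def fg)
      have "\<tau> i = \<sigma> i" if "i \<in> {1..Suc n}" for i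
        using fun_cong[OF r(1), of i] r(3) that by (cases "i = Suc n") auto
      then have "\<tau> = \<sigma>"
        by (rule extensionalityI[OF ext])
      then show "f = g"
        using r by (simp add: fg)
    qed
    show "split1 n ` Hom ?A x y = Hom ?M (split0 n x) (split0 n y)"
    proof (intro equalityI subsetI)
      fix p assume "p \<in> split1 n ` Hom ?A x y"
      then show "p \<in> Hom ?M (split0 n x) (split0 n y)"
        using iff by (auto simp: Hom)
    next
      fix p assume p: "p \<in> Hom ?M (split0 n x) (split0 n y)"
      obtain T \<tau> t where pT: "p = ((T, \<tau>), t)"
        by (metis surj_pair)
      have ext: "\<tau> \<in> extensional {1..n}"
        using p by (cases x; cases y)
          (auto simp: pT Mnd_def Mnd_tuples_def is_monad_morphism_def is_tuple1_def split0_def)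
      \<comment> \<open>The inverse of \<open>split1\<close> appends \<open>t\<close> at index
        \<open>Suc n\<close>; extensionality of \<open>\<tau>\<close> ensures that restricting
        recovers it.\<close>
      have "restrict (\<tau>(Suc n := t)) {1..n} = \<tau>"
        using ext by (auto simp: fun_eq_iff extensional_def)
      then have eq: "split1 n (T, \<tau>(Suc n := t)) = p"
        by (simp add: split1_def pT)
      moreover have "\<tau>(Suc n := t) \<in> extensional {1..Suc n}"
        using ext by (auto simp: extensional_def)
      ultimately have "(T, \<tau>(Suc n := t)) \<in> Hom ?A x y"
        using p by (simp add: Hom iff)
      then show "p \<in> split1 n ` Hom ?A x y"
        using eq by blast
    qed
  qed
  show "Cell ?M (split0 n x) (split0 n y) (split1 n f) (split1 n g) = Cell ?A x y f g" for f g
    by (cases x; cases y; cases f; cases g)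
      (auto simp: split0_def split1_def Mnd_def is_monad_2cell_def simp del: One_nat_def,
        auto simp: Mnd_tuples_def is_tuple2_def Ball_Suc simp del: One_nat_def)
qed

section \<open>The iterates\<close>

lemma rebracket1_cong:
  "(\<And>i. i \<in> {1..n} \<Longrightarrow> \<tau> i = \<sigma> i) \<Longrightarrow> rebracket1 n (T, \<tau>) = rebracket1 n (T, \<sigma>)"
  by (induction n) auto

lemma rebracket0_cong:
  "\<lbrakk>\<And>i. i \<in> {1..n} \<Longrightarrow> S i = S' i; \<And>p. p \<in> index_pairs n \<Longrightarrow> l p = l' p\<rbrakk>
    \<Longrightarrow> rebracket0 n (X, S, l) = rebracket0 n (X, S', l')"
proof (induction n)
  case (Suc n)
  have "rebracket1 n (End (S (Suc n)), \<lambda>i. l (i, Suc n)) = rebracket1 n (End (S (Suc n)), \<lambda>i. l' (i, Suc n))"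
    by (rule rebracket1_cong) (simp add: Suc.prems(2) index_pairs_Suc)
  then show ?case
    using Suc by (simp add: index_pairs_Suc)
qed simp

text \<open>Re-bracketing factors as splitting off the last entry, re-bracketing the rest one level
  down, and renaming the pair. The restriction in \<open>split1\<close> is harmless because
  \<open>rebracket1 n\<close> reads only entries up to \<open>n\<close>. The next lemma does the
  same for 0-cells.\<close>

lemma rebracket1_Suc:
  "rebracket1 (Suc n) = (\<lambda>(T, \<tau>). Pair1 T \<tau>) \<circ> (map_prod (rebracket1 n) id \<circ> split1 n)"
  by (auto simp: fun_eq_iff split1_def intro: rebracket1_cong)

lemma rebracket0_Suc:
  "rebracket0 (Suc n) =
    (\<lambda>(X, S). Pair0 X S) \<circ> (map_prod (rebracket0 n) (map_monad (rebracket1 n) id) \<circ> split0 n)"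
  by (auto simp: fun_eq_iff split0_def intro: rebracket0_cong rebracket1_cong)

lemma (in two_category) rebracket_0:
  "two_category (Mnd_tuples 0 B)"
  "relabelling (Mnd_tuples 0 B) (Mnd_pow 0 B) (rebracket0 0) (rebracket1 0)"
proof -
  have no_pairs: "index_pairs 0 = {}"
    by (auto simp: index_pairs_def)
  \<comment> \<open>With empty index sets an extensional family is constantly
    \<open>undefined\<close>, so the first projection loses no information and identifies 0-tuples
    with cells of \<open>B\<close>.\<close>
  define G0 :: "('o, 'a, 'c) tuple0 \<Rightarrow> 'o" where "G0 = fst"
  define G1 :: "('a, 'c) tuple1 \<Rightarrow> 'a" where "G1 = fst"
  have "relabelling (Mnd_tuples 0 B) B G0 G1"
    by unfold_locales
      (auto simp: G0_def G1_def Mnd_tuples_def is_tuple0_def is_tuple1_def is_tuple2_def no_pairs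
        bij_betw_def inj_on_def image_iff)
  then interpret relabelling "Mnd_tuples 0 B" B G0 G1 .
  show "two_category (Mnd_tuples 0 B)"
    by (rule two_category_domain[OF two_category_axioms])
      (auto simp: Mnd_tuples_def is_tuple0_def is_tuple1_def no_pairs
        intro: Id1_in_Hom Comp_in_Hom)
  have "rebracket0 0 = Base0 \<circ> G0" "rebracket1 0 = Base1 \<circ> G1"
    by (auto simp: G0_def G1_def fun_eq_iff)
  moreover have "relabelling (Mnd_tuples 0 B) (Mnd_pow 0 B) (Base0 \<circ> G0) (Base1 \<circ> G1)"
    unfolding Mnd_pow.simps
    by (rule relabelling_trans[OF relabelling_axioms relabelling_rename_cells(1)]) (auto simp: inj_def)
  ultimately show "relabelling (Mnd_tuples 0 B) (Mnd_pow 0 B) (rebracket0 0) (rebracket1 0)"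
    by simp
qed

lemma two_category_Mnd_pow: "two_category B \<Longrightarrow> two_category (Mnd_pow n B)"
proof (induction n)
  case 0
  then show ?case
    by (simp add: two_category_rename_cells inj_def)
next
  case (Suc n)
  then show ?case
    by (simp add: two_category_rename_cells two_category.two_category_Mnd inj_def)
qed

text \<open>The two claims are proved together: \<open>relabelling_Mnd\<close> needs the
  \<open>n\<close>-tuples to form a 2-category, and that the \<open>Suc n\<close>-tuples form one is
  pulled back from the monads in \<open>n\<close>-tuples.\<close>

lemma (in two_category) rebracket_relabelling:
  "two_category (Mnd_tuples n B)
    \<and> relabelling (Mnd_tuples n B) (Mnd_pow n B) (rebracket0 n) (rebracket1 n)"
proof (induction n)
  case 0
  show ?case using rebracket_0 by blast
next
  case (Suc n)
  then interpret T: two_category "Mnd_tuples n B"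
    + R: relabelling "Mnd_tuples n B" "Mnd_pow n B" "rebracket0 n" "rebracket1 n"
    by auto
  interpret M: two_category "Mnd (Mnd_tuples n B)"
    by (rule T.two_category_Mnd)
  interpret S: relabelling "Mnd_tuples (Suc n) B" "Mnd (Mnd_tuples n B)" "split0 n" "split1 n"
    by (rule relabelling_split)
  have "two_category (Mnd_tuples (Suc n) B)"
  proof (rule S.two_category_domain[OF M.two_category_axioms])
    fix x assume x: "x \<in> Obj (Mnd_tuples (Suc n) B)"
    let ?i = "Id1 (Mnd_tuples (Suc n) B) x"
    have "split1 n ?i \<in> Hom (Mnd (Mnd_tuples n B)) (split0 n x) (split0 n x)"
      using M.Id1_in_Hom[OF S.F0_Obj[OF x]] S.map_Id1[OF x] by simp
    \<comment> \<open>Extensionality, which \<open>split1\<close> cannot detect, comes from the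
      restricted family in the definition of \<open>Id1\<close>; composites are treated likewise
      below.\<close>
    moreover obtain T \<tau> where "?i = (T, \<tau>)" "\<tau> \<in> extensional {1..Suc n}"
      by (cases x) (auto simp: Mnd_tuples_def)
    ultimately show "?i \<in> Hom (Mnd_tuples (Suc n) B) x x"
      using x tuple1_Suc_iff[of n x x T \<tau>] by (simp add: Mnd_tuples_def)
  next
    fix x y z f g
    assume a: "x \<in> Obj (Mnd_tuples (Suc n) B)" "y \<in> Obj (Mnd_tuples (Suc n) B)"
      "z \<in> Obj (Mnd_tuples (Suc n) B)" "f \<in> Hom (Mnd_tuples (Suc n) B) x y"
      "g \<in> Hom (Mnd_tuples (Suc n) B) y z"
    let ?c = "g \<cdot>\<^bsub>Mnd_tuples (Suc n) B\<^esub> f"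
    have "split1 n ?c \<in> Hom (Mnd (Mnd_tuples n B)) (split0 n x) (split0 n z)"
      using M.Comp_in_Hom[OF S.F0_Obj[OF a(1)] S.F0_Obj[OF a(2)] S.F0_Obj[OF a(3)]
          S.F1_Hom[OF a(1,2,4)] S.F1_Hom[OF a(2,3,5)]] S.map_Comp[OF a] by simp
    moreover obtain T \<tau> where "?c = (T, \<tau>)" "\<tau> \<in> extensional {1..Suc n}"
      by (cases f; cases g) (auto simp: Mnd_tuples_def)
    ultimately show "?c \<in> Hom (Mnd_tuples (Suc n) B) x z"
      using a tuple1_Suc_iff[of n x z T \<tau>] by (simp add: Mnd_tuples_def)
  qed
  moreover have "relabelling (Mnd_tuples (Suc n) B) (Mnd_pow (Suc n) B) (rebracket0 (Suc n)) (rebracket1 (Suc n))"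
    unfolding rebracket0_Suc rebracket1_Suc Mnd_pow.simps
    \<comment> \<open>The chain runs from \<open>Suc n\<close>-tuples to monads in
      \<open>n\<close>-tuples, then by \<open>Mnd\<close> of the induction hypothesis to monads in
      \<open>Mnd_pow n B\<close>, then to their renamed copy.\<close>
    by (rule relabelling_trans[OF
          relabelling_trans[OF S.relabelling_axioms R.relabelling_Mnd[OF T.two_category_axioms]]
          relabelling_rename_cells(1)])
      (auto simp: inj_def)
  ultimately show ?case ..
qed

text \<open>A relabelling between two 2-categories is an isomorphism; the iterate is a 2-category
  because \<open>Mnd\<close> and renaming preserve this property.\<close>

theorem theorem3p6:
  fixes B :: "('o, 'a, 'c) two_cat" and n :: nat
  assumes "two_category B" and "n \<ge> 3"
  shows "two_category_iso (Mnd_tuples n B) (Mnd_pow n B) (rebracket0 n) (rebracket1 n) (\<lambda>\<alpha>. \<alpha>)"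
  using two_category.rebracket_relabelling[OF assms(1)] two_category_Mnd_pow[OF assms(1)]
  by (blast intro: relabelling.two_category_iso)

end
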